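(* Let $G$ be a finitely generated group acting strongly rigidly by locally elliptic automorphisms on an $18$-systolic complex $X$. Then $G$ acts elliptically on $X$.
   Context: A flag simplicial complex $X$ (not necessarily finite dimensional or locally finite) is $k$-large, for $k\ge 6$, if every cycle in its 1-skeleton of length smaller than $k$ (and at least 4) has a diagonal, i.e. an edge of $X$ connecting two non-consecutive vertices of the cycle. A simply connected (in particular connected) $k$-large complex is called $k$-systolic. The 1-skeleton carries the graph metric. A group $G$ acts strongly rigidly on $X$ if the only $g\in G$ stabilizing a (possibly infinite) simplex of dimension at least $1$ is the identity; here a possibly infinite simplex is a set of pairwise adjacent vertices. The action is by locally elliptic automorphisms if for each $g\in G$ the orbits of $\langle g\rangle$ are bounded; it is elliptic if the orbits of $G$ are bounded. *)

theory Defs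
  imports
    "HOL-Analysis.Analysis"
    "HOL-Algebra.Group_Action"
    "HOL-Algebra.Generated_Groups"
begin

section \<open>Flag simplicial complexes\<close>

text \<open>A complex is given by its set of (finite, nonempty) simplices; a vertex is a point \<open>v\<close>
  lying in some simplex. No bound on the dimension or on the degrees is imposed.\<close>

definition abstract_complex :: "'v set set \<Rightarrow> bool" where
  "abstract_complex X \<longleftrightarrow>
     (\<forall>\<sigma>\<in>X. finite \<sigma> \<and> \<sigma> \<noteq> {} \<and> (\<forall>\<tau>. \<tau> \<subseteq> \<sigma> \<and> \<tau> \<noteq> {} \<longrightarrow> \<tau> \<in> X))"

definition vertices :: "'v set set \<Rightarrow> 'v set" where
  "vertices X = \<Union>X"

definition adjacent :: "'v set set \<Rightarrow> 'v \<Rightarrow> 'v \<Rightarrow> bool" where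
  "adjacent X u v \<longleftrightarrow> u \<noteq> v \<and> {u, v} \<in> X"

text \<open>A possibly infinite simplex.\<close>

definition clique :: "'v set set \<Rightarrow> 'v set \<Rightarrow> bool" where
  "clique X A \<longleftrightarrow> A \<subseteq> vertices X \<and> (\<forall>u\<in>A. \<forall>v\<in>A. u \<noteq> v \<longrightarrow> adjacent X u v)"

definition flag_complex :: "'v set set \<Rightarrow> bool" where
  "flag_complex X \<longleftrightarrow> abstract_complex X \<and>
     (\<forall>A. finite A \<and> A \<noteq> {} \<and> clique X A \<longrightarrow> A \<in> X)"

section \<open>Largeness\<close>

definition cycle_in :: "'v set set \<Rightarrow> 'v list \<Rightarrow> bool" where
  "cycle_in X c \<longleftrightarrow> length c \<ge> 3 \<and> distinct c \<and>
     (\<forall>i<length c. adjacent X (c ! i) (c ! (Suc i mod length c)))"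

definition has_diagonal :: "'v set set \<Rightarrow> 'v list \<Rightarrow> bool" where
  "has_diagonal X c \<longleftrightarrow>
     (\<exists>i<length c. \<exists>j<length c. i \<noteq> j \<and> j \<noteq> Suc i mod length c \<and> i \<noteq> Suc j mod length c \<and>
        adjacent X (c ! i) (c ! j))"

definition large :: "nat \<Rightarrow> 'v set set \<Rightarrow> bool" where
  "large k X \<longleftrightarrow> 6 \<le> k \<and> flag_complex X \<and>
     (\<forall>c. cycle_in X c \<and> 4 \<le> length c \<and> length c < k \<longrightarrow> has_diagonal X c)"

section \<open>Geometric realization and simple connectedness\<close>

text \<open>Points are given by barycentric coordinates. On a single simplex the topology inherited from
  the product topology on functions is the Euclidean one; the realization carries the weak topology
  with respect to its simplices.\<close>

definition realization_points :: "'v set set \<Rightarrow> ('v \<Rightarrow> real) set" where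
  "realization_points X =
     {x. {v. x v \<noteq> 0} \<in> X \<and> (\<forall>v. 0 \<le> x v) \<and> (\<Sum>v | x v \<noteq> 0. x v) = 1}"

definition closed_cell :: "'v set set \<Rightarrow> 'v set \<Rightarrow> ('v \<Rightarrow> real) set" where
  "closed_cell X \<sigma> = {x \<in> realization_points X. {v. x v \<noteq> 0} \<subseteq> \<sigma>}"

definition realization :: "'v set set \<Rightarrow> ('v \<Rightarrow> real) topology" where
  "realization X = topology (\<lambda>U. U \<subseteq> realization_points X \<and>
     (\<forall>\<sigma>\<in>X. openin (top_of_set (closed_cell X \<sigma>)) (U \<inter> closed_cell X \<sigma>)))"

lemma openin_realization:
  "openin (realization X) U \<longleftrightarrow> U \<subseteq> realization_points X \<and>
     (\<forall>\<sigma>\<in>X. openin (top_of_set (closed_cell X \<sigma>)) (U \<inter> closed_cell X \<sigma>))"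
proof -
  have "istopology (\<lambda>U. U \<subseteq> realization_points X \<and>
     (\<forall>\<sigma>\<in>X. openin (top_of_set (closed_cell X \<sigma>)) (U \<inter> closed_cell X \<sigma>)))"
    unfolding istopology_def
  proof (intro conjI allI impI ballI)
    fix S T \<sigma>
    assume "S \<subseteq> realization_points X \<and>
        (\<forall>\<sigma>\<in>X. openin (top_of_set (closed_cell X \<sigma>)) (S \<inter> closed_cell X \<sigma>))"
      "T \<subseteq> realization_points X \<and>
        (\<forall>\<sigma>\<in>X. openin (top_of_set (closed_cell X \<sigma>)) (T \<inter> closed_cell X \<sigma>))"
    then show "S \<inter> T \<subseteq> realization_points X" by blast
  next
    fix S T \<sigma>
    assume *: "S \<subseteq> realization_points X \<and>
        (\<forall>\<sigma>\<in>X. openin (top_of_set (closed_cell X \<sigma>)) (S \<inter> closed_cell X \<sigma>))"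
      "T \<subseteq> realization_points X \<and>
        (\<forall>\<sigma>\<in>X. openin (top_of_set (closed_cell X \<sigma>)) (T \<inter> closed_cell X \<sigma>))" "\<sigma> \<in> X"
    have "(S \<inter> T) \<inter> closed_cell X \<sigma> = (S \<inter> closed_cell X \<sigma>) \<inter> (T \<inter> closed_cell X \<sigma>)" by blast
    then show "openin (top_of_set (closed_cell X \<sigma>)) (S \<inter> T \<inter> closed_cell X \<sigma>)"
      using * by (metis openin_Int)
  next
    fix \<K>
    assume "\<forall>K\<in>\<K>. K \<subseteq> realization_points X \<and>
        (\<forall>\<sigma>\<in>X. openin (top_of_set (closed_cell X \<sigma>)) (K \<inter> closed_cell X \<sigma>))"
    then show "\<Union>\<K> \<subseteq> realization_points X" by blast
  next
    fix \<K> \<sigma>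
    assume *: "\<forall>K\<in>\<K>. K \<subseteq> realization_points X \<and>
        (\<forall>\<sigma>\<in>X. openin (top_of_set (closed_cell X \<sigma>)) (K \<inter> closed_cell X \<sigma>))" "\<sigma> \<in> X"
    have "\<Union>\<K> \<inter> closed_cell X \<sigma> = (\<Union>K\<in>\<K>. K \<inter> closed_cell X \<sigma>)" by blast
    moreover have "openin (top_of_set (closed_cell X \<sigma>)) (\<Union>K\<in>\<K>. K \<inter> closed_cell X \<sigma>)"
      using * by (intro openin_Union) blast
    ultimately show "openin (top_of_set (closed_cell X \<sigma>)) (\<Union>\<K> \<inter> closed_cell X \<sigma>)" by simp
  qed
  then show ?thesis
    unfolding realization_def by (simp add: topology_inverse')
qed

text \<open>Path-connected with trivial fundamental group at every base point. This is the analogue for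
  abstract topologies of \<^const>\<open>simply_connected\<close>, which is only available for sets in the canonical
  topology of a type; the product topology on functions is not the weak topology in general.\<close>

definition simply_connected_space :: "'a topology \<Rightarrow> bool" where
  "simply_connected_space T \<longleftrightarrow> path_connected_space T \<and>
     (\<forall>p. pathin T p \<and> p 0 = p 1 \<longrightarrow>
        homotopic_with (\<lambda>r. r 0 = p 0 \<and> r 1 = p 0) (top_of_set {0..1}) T p (\<lambda>_. p 0))"

definition systolic :: "nat \<Rightarrow> 'v set set \<Rightarrow> bool" where
  "systolic k X \<longleftrightarrow> large k X \<and> simply_connected_space (realization X)"

section \<open>The graph metric\<close>

text \<open>The length of a shortest edge path between two vertices (\<open>\<infinity>\<close> if there is none).\<close>

definition graph_dist :: "'v set set \<Rightarrow> 'v \<Rightarrow> 'v \<Rightarrow> enat" where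
  "graph_dist X u v = (INF n \<in> {n. (adjacent X ^^ n) u v}. enat n)"

definition bounded_in :: "'v set set \<Rightarrow> 'v set \<Rightarrow> bool" where
  "bounded_in X A \<longleftrightarrow> (\<exists>N::nat. \<forall>u\<in>A. \<forall>v\<in>A. graph_dist X u v \<le> enat N)"

section \<open>Group actions on complexes\<close>

definition finitely_generated :: "('g, 'm) monoid_scheme \<Rightarrow> bool" where
  "finitely_generated G \<longleftrightarrow> (\<exists>S. finite S \<and> S \<subseteq> carrier G \<and> generate G S = carrier G)"

definition simplicial_action ::
    "('g, 'm) monoid_scheme \<Rightarrow> 'v set set \<Rightarrow> ('g \<Rightarrow> 'v \<Rightarrow> 'v) \<Rightarrow> bool" where
  "simplicial_action G X \<phi> \<longleftrightarrow> group_action G (vertices X) \<phi> \<and>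
     (\<forall>g\<in>carrier G. \<forall>\<sigma>. \<sigma> \<subseteq> vertices X \<longrightarrow> (\<phi> g ` \<sigma> \<in> X \<longleftrightarrow> \<sigma> \<in> X))"

text \<open>Stabilizers of simplices are setwise; a simplex has dimension at least 1 if it has two
  distinct vertices.\<close>

definition strongly_rigid ::
    "('g, 'm) monoid_scheme \<Rightarrow> 'v set set \<Rightarrow> ('g \<Rightarrow> 'v \<Rightarrow> 'v) \<Rightarrow> bool" where
  "strongly_rigid G X \<phi> \<longleftrightarrow>
     (\<forall>g\<in>carrier G. \<forall>A. clique X A \<and> (\<exists>u\<in>A. \<exists>v\<in>A. u \<noteq> v) \<and> \<phi> g ` A = A \<longrightarrow> g = \<one>\<^bsub>G\<^esub>)"

definition elliptic_action ::
    "('g, 'm) monoid_scheme \<Rightarrow> 'v set set \<Rightarrow> ('g \<Rightarrow> 'v \<Rightarrow> 'v) \<Rightarrow> bool" where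
  "elliptic_action G X \<phi> \<longleftrightarrow> (\<forall>v\<in>vertices X. bounded_in X (orbit G \<phi> v))"

definition locally_elliptic_action ::
    "('g, 'm) monoid_scheme \<Rightarrow> 'v set set \<Rightarrow> ('g \<Rightarrow> 'v \<Rightarrow> 'v) \<Rightarrow> bool" where
  "locally_elliptic_action G X \<phi> \<longleftrightarrow>
     (\<forall>g\<in>carrier G. elliptic_action (G\<lparr>carrier := generate G {g}\<rparr>) X \<phi>)"

end

theory Submission
  imports Defs
begin

text \<open>The 1-skeleton is a bridged graph: around every base vertex, the neighbours of a vertex that are
  closer to the base form a clique, and the ends of an edge in a sphere have a common closer
  neighbour. This is local-to-global: a graph with these properties, covering the given one, can be
  built ball by ball using only that there are no induced 4- and 5-cycles, and simple connectivity
  makes the covering trivial.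

  Two geodesics from a base vertex contract extremely fast towards it, since two neighbouring
  paths, one in larger and one in smaller spheres, would otherwise close up to a cycle of length
  less than 18 without diagonal. Hence geodesic triangles are thin, the graph satisfies a
  four-point inequality, and \<open>d(x,y) + d(x',y')\<close> and \<open>d(x,y') + d(x',y)\<close> differ by at most 1
  when the pairs \<open>x,x'\<close> and \<open>y,y'\<close> are far apart.

  If a nontrivial subgroup has small orbits at two distant vertices, the last fact turns the points
  at a fixed place on the shortest connections between the two orbits into an invariant clique,
  and two consecutive places contradict rigidity. So orbits of a nontrivial cyclic group spread out
  at a definite rate away from a vertex \<open>x\<close>. If some \<open>h\<close> moved \<open>x\<close> very far, suitable
  elements of that cyclic group and of its conjugate by \<open>h\<close> would have a product whose orbit of
  \<open>x\<close>, by the four-point inequality, is unbounded.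

  A cyclic group with bounded orbits need not stabilize any clique (translations acting on the
  intersection graph of all bounded intervals of the line), so fixed points are not used.\<close>

section \<open>The universal cover of a graph, ball by ball\<close>

text \<open>Simple connectivity is a topological hypothesis, while everything later is combinatorics
  of spheres; joining the two is the first obstacle. Disc diagrams and curvature counts are avoided:
  loops are contracted on a square grid by simplicial approximation, and such a grid lifts triangle
  by triangle to every graph covering in which triangles lift. Once the cover is trivial its levels
  are graph distances, so the sphere properties imposed while building it hold about every vertex of
  the complex.

  A path of \<open>h\<close> edges in a sphere descends two spheres as a path of at most
  \<open>h + 2\<close> edges; with the connecting edges the two close up to at most
  \<open>2 * h + 6\<close> edges, which stays below 18 for \<open>h \<le> 5\<close>. All geometric
  constants grow out of this bound of five.

  The final bound is uniform because it starts from one nontrivial element \<open>g\<close>: if the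
  group generated by \<open>g\<close> moves \<open>x\<close> by at most \<open>c\<close>, then every
  group element moves \<open>x\<close> by less than \<open>24 * c + 420\<close>.\<close>

locale simple_graph =
  fixes adj :: "'v \<Rightarrow> 'v \<Rightarrow> bool"
  assumes adj_sym: "adj x y \<Longrightarrow> adj y x" and adj_irrefl: "\<not> adj x x"

locale c45_free_graph = simple_graph adj for adj :: "'v \<Rightarrow> 'v \<Rightarrow> bool" +
  assumes no_C4: "\<lbrakk>adj a b; adj b c; adj c d; adj d a; a \<noteq> c; b \<noteq> d\<rbrakk> \<Longrightarrow> adj a c \<or> adj b d"
  and no_C5: "\<lbrakk>adj a b; adj b c; adj c d; adj d e; adj e a; a \<noteq> c; a \<noteq> d; b \<noteq> d; b \<noteq> e; c \<noteq> e\<rbrakk>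
     \<Longrightarrow> adj a c \<or> adj a d \<or> adj b d \<or> adj b e \<or> adj c e"

text \<open>The nodes of the cover are lists: \<open>hd\<close> is the covering map, and a node of length \<open>k + 1\<close>
  lies at distance \<open>k\<close> from the root.\<close>

locale cover_ball = c45_free_graph adj for adj :: "'v \<Rightarrow> 'v \<Rightarrow> bool" +
  fixes root :: 'v and n :: nat and B :: "'v list set" and A :: "'v list \<Rightarrow> 'v list \<Rightarrow> bool"
  assumes root: "[root] \<in> B"
    and root_unique: "\<lbrakk>y \<in> B; length y = Suc 0\<rbrakk> \<Longrightarrow> y = [root]"
    and nonempty: "y \<in> B \<Longrightarrow> y \<noteq> []"
    and level_le: "y \<in> B \<Longrightarrow> length y \<le> Suc n"
    and A_in: "A u w \<Longrightarrow> u \<in> B"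
    and A_sym: "A u w \<Longrightarrow> A w u"
    and A_adj: "A u w \<Longrightarrow> adj (hd u) (hd w)"
    and A_level: "A u w \<Longrightarrow> length u \<le> Suc (length w)"
    and A_inj: "\<lbrakk>A v y; A v y'; hd y = hd y'\<rbrakk> \<Longrightarrow> y = y'"
    and A_surj: "\<lbrakk>v \<in> B; length v \<le> n; adj (hd v) z\<rbrakk> \<Longrightarrow> \<exists>y. A v y \<and> hd y = z"
    and A_tri: "\<lbrakk>A v y; A v y'; adj (hd y) (hd y')\<rbrakk> \<Longrightarrow> A y y'"
    and A_down: "\<lbrakk>y \<in> B; Suc 0 < length y\<rbrakk> \<Longrightarrow> \<exists>t. A y t \<and> length y = Suc (length t)"
    and A_clique: "\<lbrakk>A y t; A y t'; length y = Suc (length t); length y = Suc (length t'); t \<noteq> t'\<rbrakk> \<Longrightarrow> A t t'"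
    and A_triangle: "\<lbrakk>A u v; length u = length v\<rbrakk> \<Longrightarrow> \<exists>t. A u t \<and> A v t \<and> length u = Suc (length t)"
begin

text \<open>A node of the next sphere is a class of pairs of a node \<open>t\<close> of the last sphere and a neighbour
  \<open>z\<close> of its image that is not yet covered; it is encoded as \<open>z # t\<close> for a chosen representative.\<close>

definition cand :: "'v list \<Rightarrow> 'v \<Rightarrow> bool" where
  "cand t z \<longleftrightarrow> t \<in> B \<and> length t = Suc n \<and> adj (hd t) z \<and> \<not> (\<exists>y. A t y \<and> hd y = z)"

definition cand_class :: "'v list \<Rightarrow> 'v \<Rightarrow> 'v list set" where
  "cand_class t z = {t'. cand t' z \<and> (t' = t \<or> A t t')}"

definition new :: "'v list set" where
  "new = {z # t | z t. cand t z \<and> t = (SOME t'. t' \<in> cand_class t z)}"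

definition down_set :: "'v list \<Rightarrow> 'v list set" where
  "down_set u = cand_class (tl u) (hd u)"

definition B' :: "'v list set" where "B' = B \<union> new"

definition A' :: "'v list \<Rightarrow> 'v list \<Rightarrow> bool" where
  "A' u w \<longleftrightarrow> A u w \<or> (u \<in> new \<and> w \<in> down_set u) \<or> (w \<in> new \<and> u \<in> down_set w) \<or>
     (u \<in> new \<and> w \<in> new \<and> adj (hd u) (hd w) \<and> down_set u \<inter> down_set w \<noteq> {})"

text \<open>Inside the ball every neighbour is already covered. So a neighbour \<open>z\<close> of
  \<open>hd d\<close> has a lift next to \<open>d\<close>, and by \<open>A_tri\<close> that lift is
  adjacent to \<open>t\<close>, where a candidate must be uncovered.\<close>

lemma cand_not_below:
  assumes c: "cand t z" and d: "A t d" "length t = Suc (length d)"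
  shows "\<not> adj z (hd d)"
proof
  assume "adj z (hd d)"
  then have zd: "adj (hd d) z" by (rule adj_sym)
  have "d \<in> B" "length d \<le> n" using d c A_in[OF A_sym] by (auto simp: cand_def)
  then obtain y where y: "A d y" "hd y = z" using A_surj[OF _ _ zd] by blast
  have "A t y" using A_tri[of d t y] A_sym[OF d(1)] y c by (auto simp: cand_def)
  with y c show False by (auto simp: cand_def)
qed

text \<open>Transitivity makes the classes well defined, and this is where 5-cycles matter. Take
  \<open>d\<close> below \<open>t1\<close>, \<open>t2\<close> and \<open>e\<close> below
  \<open>t2\<close>, \<open>t3\<close>. If \<open>t1\<close> and \<open>t3\<close> are not adjacent,
  the absence of 4-cycles through \<open>z\<close> keeps \<open>d\<close> away from
  \<open>t3\<close> and \<open>e\<close> away from \<open>t1\<close>. Both lie below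
  \<open>t2\<close>, hence are adjacent, and \<open>z\<close>, \<open>t1\<close>, \<open>d\<close>,
  \<open>e\<close>, \<open>t3\<close> give an induced pentagon.\<close>

lemma cand_trans:
  assumes c: "cand t1 z" "cand t2 z" "cand t3 z" and a: "A t1 t2" "A t2 t3" "t1 \<noteq> t3"
  shows "A t1 t3"
proof (rule ccontr)
  assume n13: "\<not> A t1 t3"
  have len: "length t1 = Suc n" "length t2 = Suc n" "length t3 = Suc n" using c by (auto simp: cand_def)
  have h13: "hd t1 \<noteq> hd t3" using A_inj[of t2 t1 t3] a A_sym by blast
  have na13: "\<not> adj (hd t1) (hd t3)" using A_tri[of t2 t1 t3] a A_sym n13 by blast
  obtain d where d: "A t1 d" "A t2 d" "length t1 = Suc (length d)" using A_triangle[OF a(1)] len by auto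
  obtain e where e: "A t2 e" "A t3 e" "length t2 = Suc (length e)" using A_triangle[OF a(2)] len by auto
  have zd: "\<not> adj z (hd d)" "\<not> adj z (hd e)"
    using cand_not_below[OF c(1) d(1,3)] cand_not_below[OF c(2) e(1,3)] by auto
  have zn: "z \<noteq> hd d" "z \<noteq> hd e" using c(2) d(2) e(1) by (auto simp: cand_def)
  have az: "adj z (hd t1)" "adj (hd t3) z" using c by (auto simp: cand_def intro: adj_sym)
  have ad: "adj (hd t1) (hd d)" "adj (hd d) (hd t1)" "adj (hd t3) (hd e)" "adj (hd e) (hd t3)"
    using A_adj d e adj_sym by blast+
  have d3: "\<not> adj (hd d) (hd t3)"
    using no_C4[of z "hd t1" "hd d" "hd t3"] az ad zd zn h13 na13 by blast
  have e1: "\<not> adj (hd t1) (hd e)"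
    using no_C4[of z "hd t1" "hd e" "hd t3"] az ad zd zn h13 na13 by blast
  have de: "d \<noteq> e" using d3 ad by auto
  have "A d e" using A_clique[of t2 d e] d e de len by auto
  then have ade: "adj (hd d) (hd e)" "hd d \<noteq> hd e" using A_adj adj_irrefl by metis+
  have "hd d \<noteq> hd t3" "hd t1 \<noteq> hd e" using na13 ad by auto
  then show False using no_C5[of z "hd t1" "hd d" "hd e" "hd t3"] az ad ade zd zn h13 na13 d3 e1 by blast
qed

lemma cand_class_eq: assumes "cand t z" "t' \<in> cand_class t z" shows "cand_class t' z = cand_class t z"
  using assms cand_trans A_sym unfolding cand_class_def by blast

lemma new_cons: assumes "u \<in> new"
  shows "u = hd u # tl u" "cand (tl u) (hd u)" "length u = Suc (Suc n)" "tl u = (SOME t'. t' \<in> down_set u)" "u \<notin> B"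
proof -
  obtain z t where u: "u = z # t" "cand t z" "t = (SOME t'. t' \<in> cand_class t z)" using assms by (auto simp: new_def)
  then show "u = hd u # tl u" "cand (tl u) (hd u)" "length u = Suc (Suc n)" "tl u = (SOME t'. t' \<in> down_set u)"
    by (auto simp: down_set_def cand_def)
  then show "u \<notin> B" using level_le by fastforce
qed

lemma down_setD: assumes "u \<in> new" "t \<in> down_set u"
  shows "cand t (hd u)" "t \<in> B" "length t = Suc n" "adj (hd t) (hd u)" "\<not> (A t y \<and> hd y = hd u)" "t \<notin> new"
proof -
  show c: "cand t (hd u)" using assms(2) by (simp add: down_set_def cand_class_def)
  then show "t \<in> B" "length t = Suc n" "adj (hd t) (hd u)" "\<not> (A t y \<and> hd y = hd u)"
    unfolding cand_def by blast+
  then show "t \<notin> new" using new_cons(5) by blast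
qed

lemma down_set_ne: "u \<in> new \<Longrightarrow> down_set u \<noteq> {}" 
  using new_cons(2) by (auto simp: down_set_def cand_class_def)

lemma down_set_clique: assumes "u \<in> new" "t \<in> down_set u" "t' \<in> down_set u" "t \<noteq> t'" shows "A t t'"
proof -
  have c: "cand t (hd u)" "cand (tl u) (hd u)" "cand t' (hd u)" using assms new_cons(2) by (auto simp: down_set_def cand_class_def)
  have "t = tl u \<or> A (tl u) t" "t' = tl u \<or> A (tl u) t'" using assms by (auto simp: down_set_def cand_class_def)
  then show ?thesis using cand_trans[OF c _ _ assms(4)] A_sym assms(4) by auto
qed

lemma down_set_extend: assumes "u \<in> new" "t \<in> down_set u" "cand t' (hd u)" "A t t'" shows "t' \<in> down_set u"
proof -
  have "cand_class t (hd u) = down_set u" using cand_class_eq[OF new_cons(2)] assms(1,2) by (simp add: down_set_def)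
  then show ?thesis using assms(3,4) by (auto simp: cand_class_def)
qed

lemma new_ex: assumes "cand t z" shows "\<exists>u\<in>new. hd u = z \<and> t \<in> down_set u"
proof -
  define r where "r = (SOME t'. t' \<in> cand_class t z)"
  have "t \<in> cand_class t z" using assms by (auto simp: cand_class_def)
  then have r: "r \<in> cand_class t z" unfolding r_def by (rule someI)
  then have eq: "cand_class r z = cand_class t z" using cand_class_eq assms by blast
  have "cand r z" using r by (auto simp: cand_class_def)
  then have "z # r \<in> new" using eq by (auto simp: new_def r_def)
  moreover have "t \<in> down_set (z # r)" using eq \<open>t \<in> cand_class t z\<close> by (auto simp: down_set_def)
  ultimately show ?thesis by force
qed

lemma new_uniq: assumes "u \<in> new" "w \<in> new" "hd u = hd w" "t \<in> down_set u" "t \<in> down_set w" shows "u = w"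
proof -
  have "cand_class t (hd u) = down_set u" using cand_class_eq[OF new_cons(2)[OF assms(1)], of t] assms(4) by (simp add: down_set_def)
  moreover have "cand_class t (hd w) = down_set w"
    using cand_class_eq[OF new_cons(2)[OF assms(2)], of t] assms(5) by (simp add: down_set_def)
  ultimately have "tl u = tl w" using new_cons(4) assms(1-3) by simp
  then show ?thesis using new_cons(1)[OF assms(1)] new_cons(1)[OF assms(2)] assms(3) by simp
qed

lemma new_uniq_adj: assumes "u \<in> new" "w \<in> new" "hd u = hd w" "t \<in> down_set u" "s \<in> down_set w" "A t s" shows "u = w"
proof -
  have "s \<in> down_set u" using down_set_extend[OF assms(1,4) _ assms(6)] down_setD(1)[OF assms(2,5)] assms(3) by simp
  then show ?thesis using new_uniq assms by blast
qed

lemma A_not_new: "A u w \<Longrightarrow> u \<notin> new" "A u w \<Longrightarrow> w \<notin> new"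
  using A_in A_sym new_cons(5) by blast+

section \<open>Local structure of the enlarged ball\<close>

lemma A'_sym: "A' u w \<Longrightarrow> A' w u"
  unfolding A'_def using A_sym adj_sym by blast

lemma A'_old: "v \<in> B \<Longrightarrow> A' v w \<longleftrightarrow> A v w \<or> (w \<in> new \<and> v \<in> down_set w)"
  using new_cons(5) unfolding A'_def by blast

lemma A'_new: "v \<in> new \<Longrightarrow> A' v w \<longleftrightarrow> (w \<in> down_set v) \<or> (w \<in> new \<and> adj (hd v) (hd w) \<and> down_set v \<inter> down_set w \<noteq> {})"
  using A_not_new down_setD(6) unfolding A'_def by blast

lemma A'_in: "A' u w \<Longrightarrow> u \<in> B'"
  unfolding A'_def B'_def using A_in down_setD(2) by blast

lemma A'_adj: "A' u w \<Longrightarrow> adj (hd u) (hd w)"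
  unfolding A'_def using A_adj down_setD(4) adj_sym by blast

text \<open>An old \<open>y'\<close> cannot lie below \<open>v\<close> by
  \<open>cand_not_below\<close>, so it lies on the last sphere. There \<open>hd y\<close> is
  uncovered at \<open>y'\<close> as well, since \<open>A_tri\<close> would carry a lift over to
  \<open>v\<close>; thus \<open>y'\<close> belongs to the same class as \<open>v\<close>.\<close>

lemma tri_old:
  assumes v: "v \<in> B" and a: "A' v y" "A' v y'" "adj (hd y) (hd y')" and y: "y \<in> new"
  shows "A' y y'"
proof -
  have vy: "v \<in> down_set y" using a(1) v A'_old A_not_new y by blast
  from a(2) v A'_old consider "A v y'" | "y' \<in> new" "v \<in> down_set y'" by blast
  then show ?thesis
  proof cases
    case 1
    have y'B: "y' \<in> B" using 1 A_in A_sym by blast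
    have lenv: "length v = Suc n" and cv: "cand v (hd y)" using down_setD vy y by auto
    have "length v \<noteq> Suc (length y')" using cand_not_below[OF cv 1] a(3) by blast
    moreover have "length y' \<le> Suc n" using level_le y'B by blast
    moreover have "length v \<le> Suc (length y')" using A_level 1 by blast
    ultimately have len: "length y' = Suc n" using lenv by linarith
    have "\<not> (\<exists>w. A y' w \<and> hd w = hd y)"
    proof
      assume "\<exists>w. A y' w \<and> hd w = hd y"
      then obtain w where w: "A y' w" "hd w = hd y" by blast
      have "A v w" using A_tri[of y' v w] w A_sym[OF 1] down_setD(4)[OF y vy] by simp
      then show False using down_setD(5)[OF y vy, of w] w by blast
    qed
    then have "cand y' (hd y)" using y'B len a(3) adj_sym by (auto simp: cand_def)
    then have "y' \<in> down_set y" using down_set_extend[OF y vy _ 1] by blast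
    then show ?thesis using y by (auto simp: A'_def)
  next
    case 2
    then show ?thesis using y a(3) vy by (auto simp: A'_def)
  qed
qed

lemma A'_inj_new:
  assumes v: "v \<in> new" and a: "A' v y" "A' v y'" "hd y = hd y'"
  shows "y = y'"
proof -
  \<comment> \<open>An old and a new neighbour of \<open>v\<close> cannot have the same image: the
    new one shares a node \<open>t\<close> with the class of \<open>v\<close>. If \<open>t\<close>
    is the old one, an edge would project to a loop; otherwise the old one already covers that image
    at \<open>t\<close>.\<close>
  have mixed: False if m: "y \<in> down_set v" "y' \<in> new" "down_set v \<inter> down_set y' \<noteq> {}" "hd y = hd y'" for y y'
  proof -
    from m(3) obtain t where t: "t \<in> down_set v" "t \<in> down_set y'" by auto
    show False
    proof (cases "y = t")
      case True then show False using down_setD(4)[OF m(2) t(2)] m(4) adj_irrefl by metis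
    next
      case False
      then have "A t y" using down_set_clique[OF v] t m(1) by blast
      then show False using down_setD(5)[OF m(2) t(2), of y] m(4) by blast
    qed
  qed
  show ?thesis
  proof (cases "y \<in> down_set v"; cases "y' \<in> down_set v")
    assume "y \<in> down_set v" "y' \<in> down_set v"
    then show ?thesis using down_set_clique[OF v] A_adj a(3) adj_irrefl by metis
  next
    assume y: "y \<in> down_set v" "y' \<notin> down_set v"
    then have "y' \<in> new" "down_set v \<inter> down_set y' \<noteq> {}" using a(2) A'_new[OF v] by blast+
    then show ?thesis using mixed[OF y(1)] a(3) by blast
  next
    assume y: "y \<notin> down_set v" "y' \<in> down_set v"
    then have "y \<in> new" "down_set v \<inter> down_set y \<noteq> {}" using a(1) A'_new[OF v] by blast+
    then show ?thesis using mixed[OF y(2)] a(3) by fastforce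
  next
    assume "y \<notin> down_set v" "y' \<notin> down_set v"
    then have y: "y \<in> new" "y' \<in> new" "down_set v \<inter> down_set y \<noteq> {}" "down_set v \<inter> down_set y' \<noteq> {}"
      using a A'_new[OF v] by blast+
    then obtain t t' where t: "t \<in> down_set v" "t \<in> down_set y" "t' \<in> down_set v" "t' \<in> down_set y'" by blast
    show ?thesis
      using new_uniq[OF y(1,2) a(3)] new_uniq_adj[OF y(1,2) a(3)] t down_set_clique[OF v t(1,3)] by metis
  qed
qed

lemma A'_inj:
  assumes a: "A' v y" "A' v y'" "hd y = hd y'"
  shows "y = y'"
proof (cases "v \<in> new")
  case True then show ?thesis using A'_inj_new a by blast
next
  case False
  then have v: "v \<in> B" using A'_in[OF a(1)] by (auto simp: B'_def)
  consider "A v y" "A v y'" | "A v y" "y' \<in> new" "v \<in> down_set y'" | "A v y'" "y \<in> new" "v \<in> down_set y"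
    | "y \<in> new" "v \<in> down_set y" "y' \<in> new" "v \<in> down_set y'" using a(1,2) A'_old[OF v] by blast
  then show ?thesis
  proof cases
    case 1 then show ?thesis using A_inj a(3) by blast
  next
    case 2 then show ?thesis using down_setD(5)[of y' v y] a(3) by blast
  next
    case 3 then show ?thesis using down_setD(5)[of y v y'] a(3) by simp
  next
    case 4 then show ?thesis using new_uniq a(3) by blast
  qed
qed

lemma tri_new_mixed:
  assumes v: "v \<in> new" and y: "y \<in> down_set v" and y': "y' \<in> new" "down_set v \<inter> down_set y' \<noteq> {}" and ad: "adj (hd y) (hd y')"
  shows "y \<in> down_set y'"
proof -
  obtain t where t: "t \<in> down_set v" "t \<in> down_set y'" using y' by blast
  show ?thesis
  proof (cases "y = t")
    case True then show ?thesis using t by simp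
  next
    case False
    then have ty: "A t y" using down_set_clique[OF v] t y by blast
    have tB: "t \<in> B" using down_setD(2)[OF v t(1)] .
    have "A' t y'" "A' t y" using t y' ty by (auto simp: A'_def)
    then have "A' y' y" using tri_old[OF tB _ _ adj_sym[OF ad] y'(1)] by blast
    then show ?thesis using A'_new[OF y'(1)] down_setD(6)[OF v y] by blast
  qed
qed

lemma A'_tri:
  assumes a: "A' v y" "A' v y'" "adj (hd y) (hd y')"
  shows "A' y y'"
proof (cases "v \<in> new")
  case False
  then have v: "v \<in> B" using A'_in[OF a(1)] by (auto simp: B'_def)
  consider "y \<in> new" | "y' \<in> new" | "A v y" "A v y'" using a A'_old[OF v] by blast
  then show ?thesis
    using tri_old[OF v a] tri_old[OF v a(2,1) adj_sym[OF a(3)]] A'_sym A_tri[OF _ _ a(3)] 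
    by cases (auto simp: A'_def)
next
  case v: True
  show ?thesis
  proof (cases "y \<in> down_set v"; cases "y' \<in> down_set v")
    assume "y \<in> down_set v" "y' \<in> down_set v"
    then show ?thesis using down_set_clique[OF v, of y y'] a(3) adj_irrefl unfolding A'_def by metis
  next
    assume y: "y \<in> down_set v" "y' \<notin> down_set v"
    then have "y' \<in> new" "down_set v \<inter> down_set y' \<noteq> {}" using a(2) A'_new[OF v] by blast+
    then show ?thesis using tri_new_mixed[OF v y(1) _ _ a(3)] by (auto simp: A'_def)
  next
    assume y: "y \<notin> down_set v" "y' \<in> down_set v"
    then have "y \<in> new" "down_set v \<inter> down_set y \<noteq> {}" using a(1) A'_new[OF v] by blast+
    then show ?thesis using tri_new_mixed[OF v y(2) _ _ adj_sym[OF a(3)]] by (auto simp: A'_def)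
  next
    assume "y \<notin> down_set v" "y' \<notin> down_set v"
    then have y: "y \<in> new" "y' \<in> new" "down_set v \<inter> down_set y \<noteq> {}" "down_set v \<inter> down_set y' \<noteq> {}"
      using a A'_new[OF v] by blast+
    then obtain t t' where t: "t \<in> down_set v" "t \<in> down_set y" "t' \<in> down_set v" "t' \<in> down_set y'" by blast
    show ?thesis
    proof (cases "t \<in> down_set y' \<or> t' \<in> down_set y")
      case True
      then show ?thesis using t y a(3) by (auto simp: A'_def)
    next
      \<comment> \<open>Neither chosen node lies in all three classes. The images of
        \<open>t\<close>, \<open>t'\<close>, \<open>y'\<close>, \<open>y\<close> form a 4-cycle
        without diagonal, because by \<open>tri_new_mixed\<close> a diagonal would put
        \<open>t\<close> or \<open>t'\<close> into the missing class.\<close>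
      case False
      then have "t \<noteq> t'" using t by auto
      then have tt: "adj (hd t) (hd t')" using down_set_clique[OF v t(1,3)] A_adj by blast
      have ad: "adj (hd t') (hd y')" "adj (hd y) (hd t)" using down_setD(4) y t adj_sym by blast+
      have "\<not> adj (hd t) (hd y')" "\<not> adj (hd t') (hd y)"
        using tri_new_mixed[OF v t(1) y(2,4)] tri_new_mixed[OF v t(3) y(1,3)] False by blast+
      moreover have "hd t \<noteq> hd y'" "hd t' \<noteq> hd y"
        using A'_inj[of v t y'] A'_inj[of v t' y] a t v down_setD(6)[OF v] y unfolding A'_def by blast+
      ultimately have False using no_C4[of "hd t" "hd t'" "hd y'" "hd y"] tt ad a(3) adj_sym by metis
      then show ?thesis ..
    qed
  qed
qed

lemma A'_level: "A' u w \<Longrightarrow> length u \<le> Suc (length w)"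
  unfolding A'_def using A_level new_cons(3) down_setD(3) by fastforce

lemma A'_surj: assumes "v \<in> B'" "length v \<le> Suc n" "adj (hd v) z" shows "\<exists>y. A' v y \<and> hd y = z"
proof -
  have v: "v \<in> B" using assms new_cons(3) by (fastforce simp: B'_def)
  show ?thesis
  proof (cases "\<exists>y. A v y \<and> hd y = z")
    case True then show ?thesis by (auto simp: A'_def)
  next
    case False
    then have "length v = Suc n" using A_surj[OF v _ assms(3)] assms(2) by force
    then have "cand v z" using False v assms by (auto simp: cand_def)
    then show ?thesis using new_ex by (force simp: A'_def)
  qed
qed

lemma A'_down: assumes "y \<in> B'" "Suc 0 < length y" shows "\<exists>t. A' y t \<and> length y = Suc (length t)"
proof (cases "y \<in> new")
  case True
  then obtain t where "t \<in> down_set y" using down_set_ne by blast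
  then show ?thesis using True down_setD(3) new_cons(3) by (auto simp: A'_def)
next
  case False
  then show ?thesis using assms A_down by (force simp: A'_def B'_def)
qed

lemma A'_clique:
  assumes "A' y t" "A' y t'" "length y = Suc (length t)" "length y = Suc (length t')" "t \<noteq> t'"
  shows "A' t t'"
proof (cases "y \<in> new")
  case True
  then have "t \<notin> new" "t' \<notin> new" using assms(3,4) new_cons(3) by force+
  then have "t \<in> down_set y" "t' \<in> down_set y" using assms(1,2) A'_new[OF True] by blast+
  then show ?thesis using down_set_clique[OF True] assms(5) by (auto simp: A'_def)
next
  case False
  then have y: "y \<in> B" using A'_in[OF assms(1)] by (auto simp: B'_def)
  then have "t \<notin> new" "t' \<notin> new" using assms(3,4) new_cons(3) level_le by force+
  then show ?thesis using assms A_clique[of y t t'] A'_old[OF y] by (auto simp: A'_def)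
qed

lemma A'_triangle:
  assumes "A' u v" "length u = length v" shows "\<exists>t. A' u t \<and> A' v t \<and> length u = Suc (length t)"
proof (cases "u \<in> new")
  case u: True
  then have "v \<notin> down_set u" using assms(2) down_setD(3)[OF u] new_cons(3)[OF u] by force
  then have v: "v \<in> new" "down_set u \<inter> down_set v \<noteq> {}" using assms(1) A'_new[OF u] by blast+
  then obtain t where "t \<in> down_set u" "t \<in> down_set v" by blast
  then have "A' u t" "A' v t" "length u = Suc (length t)"
    using u v down_setD(3)[OF u] new_cons(3)[OF u] by (auto simp: A'_def)
  then show ?thesis by blast
next
  case False
  then have u: "u \<in> B" using A'_in[OF assms(1)] by (auto simp: B'_def)
  then have "v \<notin> new" using assms(2) new_cons(3) level_le by force
  then have "A u v" using assms(1) A'_old[OF u] by blast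
  then show ?thesis using A_triangle[OF _ assms(2)] by (auto simp: A'_def)
qed

lemma cover_ball_step: "cover_ball adj root (Suc n) B' A'"
proof unfold_locales
  show "[root] \<in> B'" using root by (auto simp: B'_def)
  show "y = [root]" if "y \<in> B'" "length y = Suc 0" for y
    using that root_unique new_cons(3) by (force simp: B'_def)
  show "y \<noteq> []" if "y \<in> B'" for y using that nonempty new_cons(3) by (force simp: B'_def)
  show "length y \<le> Suc (Suc n)" if "y \<in> B'" for y
    using that level_le new_cons(3) by (force simp: B'_def)
qed (fact A'_in A'_sym A'_adj A'_level A'_inj A'_surj A'_tri A'_down A'_clique A'_triangle)+

lemma B_B': "B \<subseteq> B'" by (auto simp: B'_def)
lemma A_A': "A u w \<Longrightarrow> A' u w" by (auto simp: A'_def)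

end

section \<open>Lifting paths and grid homotopies to a covering graph\<close>

definition (in simple_graph) near :: "'v \<Rightarrow> 'v \<Rightarrow> bool" where
  "near x y \<longleftrightarrow> x = y \<or> adj x y"

context simple_graph begin

lemma near_refl [simp]: "near x x" by (simp add: near_def)
lemma near_sym: "near x y \<Longrightarrow> near y x" by (auto simp: near_def adj_sym)

text \<open>A simplicial approximation \<open>w\<close> of a null-homotopy of the closed path \<open>c\<close>, on a square grid;
  along the bottom side it follows \<open>c\<close> with the (not necessarily monotone) reparametrization \<open>f\<close>.\<close>

definition grid_null :: "(nat \<Rightarrow> 'v) \<Rightarrow> nat \<Rightarrow> bool" where
  "grid_null c m \<longleftrightarrow> (\<exists>N w f.
     (\<forall>i i' j j'. i \<le> N \<and> i' \<le> N \<and> j \<le> N \<and> j' \<le> N \<and> i \<le> Suc i' \<and> i' \<le> Suc i \<and> j \<le> Suc j' \<and> j' \<le> Suc j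
        \<longrightarrow> near (w i j) (w i' j')) \<and>
     (\<forall>j\<le>N. w 0 j = c 0 \<and> w N j = c 0) \<and> (\<forall>i\<le>N. w i N = c 0) \<and>
     (\<forall>i\<le>N. w i 0 = c (f i) \<and> f i \<le> m) \<and> f 0 = 0 \<and> f N = m \<and>
     (\<forall>i<N. f i \<le> Suc (f (Suc i)) \<and> f (Suc i) \<le> Suc (f i)))"

end

text \<open>\<open>cov_inj\<close> and \<open>cov_surj\<close> give unique path lifting;
  \<open>cov_tri\<close> lifts triangles and so makes the end of a lifted path invariant under
  homotopy.\<close>

locale graph_covering = simple_graph adj for adj :: "'v \<Rightarrow> 'v \<Rightarrow> bool" +
  fixes Y :: "'y set" and A :: "'y \<Rightarrow> 'y \<Rightarrow> bool" and \<pi> :: "'y \<Rightarrow> 'v"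
  assumes cov_in: "A u w \<Longrightarrow> w \<in> Y"
    and cov_sym: "A u w \<Longrightarrow> A w u"
    and cov_adj: "A u w \<Longrightarrow> adj (\<pi> u) (\<pi> w)"
    and cov_inj: "\<lbrakk>A v y; A v y'; \<pi> y = \<pi> y'\<rbrakk> \<Longrightarrow> y = y'"
    and cov_surj: "\<lbrakk>v \<in> Y; adj (\<pi> v) z\<rbrakk> \<Longrightarrow> \<exists>y. A v y \<and> \<pi> y = z"
    and cov_tri: "\<lbrakk>A v y; A v y'; adj (\<pi> y) (\<pi> y')\<rbrakk> \<Longrightarrow> A y y'"
begin

definition cnear :: "'y \<Rightarrow> 'y \<Rightarrow> bool" where "cnear u w \<longleftrightarrow> u = w \<or> A u w"

lemma cnear_sym: "cnear u w \<Longrightarrow> cnear w u" by (auto simp: cnear_def cov_sym)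
lemma cnear_eq: "cnear u w \<Longrightarrow> \<pi> u = \<pi> w \<Longrightarrow> u = w"
  using cov_adj adj_irrefl by (force simp: cnear_def)

lemma cnear_tri: assumes "cnear v y" "cnear v y'" "near (\<pi> y) (\<pi> y')" shows "cnear y y'"
  using assms cov_sym cov_inj cov_tri unfolding cnear_def near_def by blast

lemma lift_ex: "\<lbrakk>y \<in> Y; near (\<pi> y) z\<rbrakk> \<Longrightarrow> \<exists>y'. cnear y y' \<and> \<pi> y' = z"
  using cov_surj unfolding near_def cnear_def by blast

definition lift :: "'y \<Rightarrow> 'v \<Rightarrow> 'y" where "lift y z = (SOME y'. cnear y y' \<and> \<pi> y' = z)"

lemma lift: assumes "y \<in> Y" "near (\<pi> y) z" shows "cnear y (lift y z)" "\<pi> (lift y z) = z" "lift y z \<in> Y"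
proof -
  show "cnear y (lift y z)" "\<pi> (lift y z) = z"
    using someI_ex[OF lift_ex[OF assms]] by (auto simp: lift_def)
  then show "lift y z \<in> Y" using assms cov_in by (auto simp: cnear_def)
qed

primrec lift_path :: "'y \<Rightarrow> (nat \<Rightarrow> 'v) \<Rightarrow> nat \<Rightarrow> 'y" where
  "lift_path y c 0 = y" |
  "lift_path y c (Suc i) = lift (lift_path y c i) (c (Suc i))"

lemma lift_path:
  assumes "y \<in> Y" "\<pi> y = c 0" "\<forall>i<m. near (c i) (c (Suc i))" "i \<le> m"
  shows "lift_path y c i \<in> Y \<and> \<pi> (lift_path y c i) = c i"
  using assms(4)
proof (induction i)
  case (Suc i) then show ?case using lift[of "lift_path y c i" "c (Suc i)"] assms(3) by auto
qed (use assms in auto)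

lemma lift_path_near:
  assumes "y \<in> Y" "\<pi> y = c 0" "\<forall>i<m. near (c i) (c (Suc i))" "i < m"
  shows "cnear (lift_path y c i) (lift_path y c (Suc i))"
  using lift_path[OF assms(1-3), of i] assms(3) assms(4) lift(1) by simp

lemma lift_path_unique:
  assumes "y \<in> Y" "\<pi> y = c 0" "\<forall>i<m. near (c i) (c (Suc i))"
    and h: "h 0 = y" "\<And>i. i \<le> m \<Longrightarrow> \<pi> (h i) = c i" "\<And>i. i < m \<Longrightarrow> cnear (h i) (h (Suc i))"
  shows "i \<le> m \<Longrightarrow> lift_path y c i = h i"
proof (induction i)
  case (Suc i)
  have "cnear (lift_path y c i) (lift_path y c (Suc i))"
    using lift_path_near[OF assms(1-3)] Suc.prems by auto
  then have "cnear (h i) (lift_path y c (Suc i))" using Suc by simp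
  then have "cnear (lift_path y c (Suc i)) (h (Suc i))"
    using cnear_tri[of "h i"] h(3)[of i] h(2)[of "Suc i"] Suc.prems lift_path[OF assms(1-3), of "Suc i"] by auto
  then show ?case using cnear_eq h(2)[of "Suc i"] Suc.prems lift_path[OF assms(1-3), of "Suc i"] by auto
qed (use h in auto)

text \<open>All rows are lifted from \<open>y\<close>. Lifts of neighbouring rows stay near each
  other column by column, and along the constant right side near lifts coincide, so all rows end at
  the same point. The top row is constant and ends at \<open>y\<close>; hence so does the bottom
  one.\<close>

lemma grid_null_lift:
  assumes y: "y \<in> Y" "\<pi> y = c 0" and c: "\<forall>i<m. near (c i) (c (Suc i))" and null: "grid_null c m"
  shows "lift_path y c m = y"
proof -
  obtain N w f where *:
     "\<forall>i i' j j'. i \<le> N \<and> i' \<le> N \<and> j \<le> N \<and> j' \<le> N \<and> i \<le> Suc i' \<and> i' \<le> Suc i \<and> j \<le> Suc j' \<and> j' \<le> Suc j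
        \<longrightarrow> near (w i j) (w i' j')"
     "\<forall>j\<le>N. w 0 j = c 0 \<and> w N j = c 0" "\<forall>i\<le>N. w i N = c 0"
     "\<forall>i\<le>N. w i 0 = c (f i) \<and> f i \<le> m" "f 0 = 0" "f N = m"
     "\<forall>i<N. f i \<le> Suc (f (Suc i)) \<and> f (Suc i) \<le> Suc (f i)"
    using null unfolding grid_null_def by (elim exE conjE)
  have w: "near (w i j) (w i' j')"
    if "i \<le> N" "i' \<le> N" "j \<le> N" "j' \<le> N" "i \<le> Suc i'" "i' \<le> Suc i" "j \<le> Suc j'" "j' \<le> Suc j" for i i' j j'
    using *(1) that by simp
  have w0: "w 0 j = c 0" and wN: "w N j = c 0" and wt: "w j N = c 0" and wb: "w j 0 = c (f j)" and fm: "f j \<le> m"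
    if "j \<le> N" for j
    using *(2-4) that by auto
  have f: "f 0 = 0" "f N = m" "\<And>i. i < N \<Longrightarrow> f i \<le> Suc (f (Suc i)) \<and> f (Suc i) \<le> Suc (f i)"
    using *(5-7) by auto
  define r where "r j = (\<lambda>i. w i j)" for j
  define l where "l j = lift_path y (r j)" for j
  have rs: "\<forall>i<N. near (r j i) (r j (Suc i))" if "j \<le> N" for j
    unfolding r_def using w that by auto
  have r0: "\<pi> y = r j 0" if "j \<le> N" for j using y w0 that by (simp add: r_def)
  have l: "l j i \<in> Y" "\<pi> (l j i) = w i j" if "i \<le> N" "j \<le> N" for i j
    using lift_path[OF y(1) r0 rs, of j i] that by (auto simp: l_def r_def)
  have ls: "cnear (l j i) (l j (Suc i))" if "i < N" "j \<le> N" for i j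
    unfolding l_def by (rule lift_path_near[OF y(1) r0 rs]) (use that in auto)
  have adjrow: "cnear (l j i) (l (Suc j) i)" if "j < N" "i \<le> N" for i j
    using that(2)
  proof (induction i)
    case 0 then show ?case by (simp add: l_def cnear_def)
  next
    case (Suc i)
    have n: "near (w (Suc i) j) (w i (Suc j))" "near (w (Suc i) j) (w (Suc i) (Suc j))"
      by (rule w; use Suc.prems that in simp)+
    \<comment> \<open>Each grid square is cut along a diagonal, and its two triangles are lifted one
      after the other.\<close>
    have "cnear (l j (Suc i)) (l (Suc j) i)"
      by (rule cnear_tri[OF ls Suc.IH]) (use Suc.prems that n l in auto)
    then have "cnear (l (Suc j) i) (l j (Suc i))" by (rule cnear_sym)
    then show ?case
      by (rule cnear_tri[OF _ ls]) (use Suc.prems that n l in auto)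
  qed
  have "l j N = l 0 N" if "j \<le> N" for j
    using that
  proof (induction j)
    case (Suc j)
    then have "l j N = l (Suc j) N" using cnear_eq[OF adjrow, of j N] l wN by simp
    then show ?case using Suc by simp
  qed simp
  then have "l N N = l 0 N" by blast
  moreover have "l N i = y" if "i \<le> N" for i
    unfolding l_def
    by (rule lift_path_unique[where m = N and h = "\<lambda>_. y"])
      (use rs[of N] r0[of N] that wt y in \<open>auto simp: cnear_def r_def\<close>)
  ultimately have l0: "l 0 N = y" by simp
  \<comment> \<open>The lift of \<open>c\<close> read along \<open>f\<close> is a lift of the bottom
    row, even where \<open>f\<close> steps backwards, since \<open>cnear\<close> is symmetric.
    Uniqueness of lifts identifies the two.\<close>
  define h where "h i = lift_path y c (f i)" for i
  have "cnear (h i) (h (Suc i))" if iN: "i < N" for i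
  proof -
    consider "f i = f (Suc i)" | "f i = Suc (f (Suc i))" | "f (Suc i) = Suc (f i)" using f(3)[OF iN] by linarith
    then show ?thesis
    proof cases
      case 1 then show ?thesis by (simp add: h_def cnear_def)
    next
      case 2
      have "f (Suc i) < m" using 2 fm[of i] iN by simp
      from lift_path_near[OF y c this] show ?thesis unfolding h_def 2 by (metis cnear_sym)
    next
      case 3
      have "f i < m" using 3 fm[of "Suc i"] iN by simp
      from lift_path_near[OF y c this] show ?thesis unfolding h_def 3 by simp
    qed
  qed
  then have "l 0 N = h N"
    unfolding l_def
    by (intro lift_path_unique[where m = N])
      (use rs[of 0] r0[of 0] y f lift_path[OF y c] wb fm in \<open>auto simp: h_def r_def\<close>)
  then show ?thesis using l0 f by (simp add: h_def)
qed

lemma walk_proj: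
  assumes "(A ^^ k) y0 y"
  shows "\<exists>h. h 0 = y0 \<and> h k = y \<and> (\<forall>i<k. A (h i) (h (Suc i)))"
  using assms by (simp add: relpowp_fun_conv)

text \<open>A path to \<open>u\<close> followed by the reverse of a path to \<open>w\<close>
  projects to a loop. Its lift closes up; read from the start it follows the first path to
  \<open>u\<close>, read backwards from the end it follows the second path to \<open>w\<close>, and
  both arrive at the same index.\<close>

lemma inj_if_null:
  assumes null: "\<And>c m. \<lbrakk>c 0 = \<pi> y0; c m = \<pi> y0; \<forall>i<m. near (c i) (c (Suc i))\<rbrakk> \<Longrightarrow> grid_null c m"
    and y0: "y0 \<in> Y" and u: "A\<^sup>*\<^sup>* y0 u" and w: "A\<^sup>*\<^sup>* y0 w" and eq: "\<pi> u = \<pi> w"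
  shows "u = w"
proof -
  obtain k h where h: "h 0 = y0" "h k = u" "\<And>i. i < k \<Longrightarrow> A (h i) (h (Suc i))"
    using u walk_proj by (metis rtranclp_imp_relpowp)
  obtain k' h' where h': "h' 0 = y0" "h' k' = w" "\<And>i. i < k' \<Longrightarrow> A (h' i) (h' (Suc i))"
    using w walk_proj by (metis rtranclp_imp_relpowp)
  define c where "c i = (if i \<le> k then \<pi> (h i) else \<pi> (h' (k + k' - i)))" for i
  have cs: "\<forall>i<k + k'. near (c i) (c (Suc i))"
  proof (intro allI impI)
    fix i assume that: "i < k + k'"
    consider "i < k" | "i = k" | "i > k" by linarith
    then show "near (c i) (c (Suc i))"
    proof cases
      case 1 then show "near (c i) (c (Suc i))" using cov_adj[OF h(3)[of i]] by (simp add: c_def near_def)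
    next
      case 2
      then have "adj (\<pi> (h' (k' - Suc 0))) (\<pi> (h' k'))" using cov_adj[OF h'(3)[of "k' - Suc 0"]] that by simp
      then show "near (c i) (c (Suc i))" using 2 h h' eq adj_sym by (auto simp: c_def near_def)
    next
      case 3
      define q where "q = k + k' - Suc i"
      have q: "k + k' - i = Suc q" "q < k'" using that 3 by (auto simp: q_def)
      have "adj (\<pi> (h' (Suc q))) (\<pi> (h' q))" by (rule adj_sym[OF cov_adj[OF h'(3)[OF q(2)]]])
      then show "near (c i) (c (Suc i))" using 3 q by (simp add: c_def near_def q_def[symmetric])
    qed
  qed
  have c0: "c 0 = \<pi> y0" using h by (simp add: c_def)
  have cm: "c (k + k') = \<pi> y0" using h h' eq by (cases "k' = 0") (auto simp: c_def)
  have closed: "lift_path y0 c (k + k') = y0"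
    by (rule grid_null_lift[OF y0 c0[symmetric] cs null[OF c0 cm cs]])
  have csk: "\<forall>i<k. near (c i) (c (Suc i))" using cs by simp
  have lk: "lift_path y0 c k = h k"
  proof (rule lift_path_unique[where h = h and c = c, OF y0 c0[symmetric] csk h(1)])
    show "\<pi> (h i) = c i" if "i \<le> k" for i using that by (simp add: c_def)
    show "cnear (h i) (h (Suc i))" if "i < k" for i using h(3)[OF that] by (simp add: cnear_def)
  qed simp
  have "lift_path y0 c (k + k' - i) = h' i" if "i \<le> k'" for i
    using that
  proof (induction i)
    case 0 then show ?case using closed h'(1) by simp
  next
    case (Suc i)
    define q where "q = k + k' - Suc i"
    have q: "k + k' - i = Suc q" "q < k + k'" using Suc.prems by (auto simp: q_def)
    have "cnear (lift_path y0 c q) (h' i)"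
      using lift_path_near[OF y0 c0[symmetric] cs q(2)] Suc q by simp
    then have n1: "cnear (h' i) (lift_path y0 c q)" by (rule cnear_sym)
    have n2: "cnear (h' i) (h' (Suc i))" using h'(3)[of i] Suc.prems by (simp add: cnear_def)
    have "c q = \<pi> (h' (Suc i))" using Suc.prems h h' eq by (cases "Suc i = k'") (auto simp: c_def q_def)
    then have p: "\<pi> (lift_path y0 c q) = \<pi> (h' (Suc i))"
      using lift_path[OF y0 c0[symmetric] cs, of q] q by simp
    then show ?case using cnear_eq[OF cnear_tri[OF n1 n2]] by (simp add: q_def)
  qed
  from this[of k'] show ?thesis using lk h(2) h'(2) by simp
qed

end

section \<open>The full cover as the union of its balls\<close>

context c45_free_graph begin

primrec ball_seq :: "'v \<Rightarrow> nat \<Rightarrow> 'v list set \<times> ('v list \<Rightarrow> 'v list \<Rightarrow> bool)" where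
  "ball_seq r 0 = ({[r]}, \<lambda>_ _. False)" |
  "ball_seq r (Suc n) = (cover_ball.B' adj n (fst (ball_seq r n)) (snd (ball_seq r n)),
     cover_ball.A' adj n (fst (ball_seq r n)) (snd (ball_seq r n)))"

lemma ball_seq: "cover_ball adj r n (fst (ball_seq r n)) (snd (ball_seq r n))"
proof (induction n)
  case 0 show ?case by unfold_locales auto
next
  case (Suc n) then show ?case using cover_ball.cover_ball_step by simp
qed

definition cov_nodes where "cov_nodes r = (\<Union>n. fst (ball_seq r n))"
definition cov_edge where "cov_edge r u w \<longleftrightarrow> (\<exists>n. snd (ball_seq r n) u w)"

lemma ball_seq_mono: assumes "n \<le> m"
  shows "fst (ball_seq r n) \<subseteq> fst (ball_seq r m)" "snd (ball_seq r n) \<le> snd (ball_seq r m)"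
proof -
  have "fst (ball_seq r n) \<subseteq> fst (ball_seq r m) \<and> snd (ball_seq r n) \<le> snd (ball_seq r m)"
    using assms
  proof (induction m rule: dec_induct)
    case (step m)
    then show ?case using cover_ball.B_B'[OF ball_seq, of r m] cover_ball.A_A'[OF ball_seq, of r m] by fastforce
  qed auto
  then show "fst (ball_seq r n) \<subseteq> fst (ball_seq r m)" "snd (ball_seq r n) \<le> snd (ball_seq r m)" by auto
qed

lemma common_level2:
  assumes "cov_edge r u w" "cov_edge r u' w'"
  obtains n where "snd (ball_seq r n) u w" "snd (ball_seq r n) u' w'"
proof -
  obtain n m where n: "snd (ball_seq r n) u w" "snd (ball_seq r m) u' w'" using assms by (auto simp: cov_edge_def)
  have "snd (ball_seq r (max n m)) u w" "snd (ball_seq r (max n m)) u' w'"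
    using n ball_seq_mono(2)[of n "max n m" r] ball_seq_mono(2)[of m "max n m" r] by auto
  then show thesis by (rule that)
qed

lemma cov_edge_I: "snd (ball_seq r n) u w \<Longrightarrow> cov_edge r u w" by (auto simp: cov_edge_def)

sublocale cov: graph_covering adj "cov_nodes r" "cov_edge r" hd for r
proof unfold_locales
  fix u w assume "cov_edge r u w"
  then obtain n where n: "snd (ball_seq r n) u w" by (auto simp: cov_edge_def)
  interpret b: cover_ball adj r n "fst (ball_seq r n)" "snd (ball_seq r n)" by (rule ball_seq)
  show "w \<in> cov_nodes r" using b.A_in[OF b.A_sym[OF n]] by (auto simp: cov_nodes_def)
  show "cov_edge r w u" using b.A_sym[OF n] by (rule cov_edge_I)
  show "adj (hd u) (hd w)" using b.A_adj[OF n] .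
next
  fix v y y' assume a: "cov_edge r v y" "cov_edge r v y'"
  obtain n where n: "snd (ball_seq r n) v y" "snd (ball_seq r n) v y'" using common_level2[OF a] by blast
  interpret b: cover_ball adj r n "fst (ball_seq r n)" "snd (ball_seq r n)" by (rule ball_seq)
  show "y = y'" if "hd y = hd y'" using b.A_inj[OF n that] .
  show "cov_edge r y y'" if "adj (hd y) (hd y')" using b.A_tri[OF n that] by (rule cov_edge_I)
next
  fix v z assume v: "v \<in> cov_nodes r" "adj (hd v) z"
  obtain n where n: "v \<in> fst (ball_seq r n)" using v by (auto simp: cov_nodes_def)
  \<comment> \<open>Raising the radius by \<open>length v\<close> puts \<open>v\<close> strictly
    inside the ball, where all its neighbours are lifted.\<close>
  have n': "v \<in> fst (ball_seq r (n + length v))" using n ball_seq_mono(1)[of n "n + length v" r] by auto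
  interpret b: cover_ball adj r "n + length v" "fst (ball_seq r (n + length v))" "snd (ball_seq r (n + length v))" by (rule ball_seq)
  obtain y where "snd (ball_seq r (n + length v)) v y" "hd y = z" using b.A_surj[OF n' _ v(2)] by auto
  then show "\<exists>y. cov_edge r v y \<and> hd y = z" using cov_edge_I by blast
qed

lemma cov_root: "[r] \<in> cov_nodes r"
  using ball_seq.simps(1)[of r] by (auto simp: cov_nodes_def intro!: exI[of _ 0])

lemma cov_level: "cov_edge r u w \<Longrightarrow> length u \<le> Suc (length w)"
  using cover_ball.A_level[OF ball_seq] by (auto simp: cov_edge_def)

lemma cov_down: assumes "y \<in> cov_nodes r" "Suc 0 < length y"
  shows "\<exists>t. cov_edge r y t \<and> length y = Suc (length t)"
  using assms cover_ball.A_down[OF ball_seq] cov_edge_I by (metis UN_E cov_nodes_def)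

lemma cov_clique:
  assumes a: "cov_edge r y t" "cov_edge r y t'" and "length y = Suc (length t)" "length y = Suc (length t')" "t \<noteq> t'"
  shows "cov_edge r t t'"
proof -
  obtain n where n: "snd (ball_seq r n) y t" "snd (ball_seq r n) y t'" using common_level2[OF a] by blast
  show ?thesis using cover_ball.A_clique[OF ball_seq n assms(3-5)] by (rule cov_edge_I)
qed

lemma cov_triangle: assumes "cov_edge r u v" "length u = length v"
  shows "\<exists>t. cov_edge r u t \<and> cov_edge r v t \<and> length u = Suc (length t)"
  using assms cover_ball.A_triangle[OF ball_seq] unfolding cov_edge_def by blast

lemma cov_conn: assumes "y \<in> cov_nodes r" shows "(cov_edge r)\<^sup>*\<^sup>* [r] y"
  using assms
proof (induction "length y" arbitrary: y rule: less_induct)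
  case less
  obtain n where n: "y \<in> fst (ball_seq r n)" using less.prems by (auto simp: cov_nodes_def)
  show ?case
  proof (cases "Suc 0 < length y")
    case True
    obtain t where t: "cov_edge r y t" "length y = Suc (length t)" using cov_down[OF less.prems True] by blast
    have "(cov_edge r)\<^sup>*\<^sup>* [r] t" using less.hyps[of t] t cov.cov_in[OF t(1)] by simp
    then show ?thesis using cov.cov_sym[OF t(1)] by simp
  next
    case False
    have "y \<noteq> []" using cover_ball.nonempty[OF ball_seq n] .
    then have "length y = Suc 0" using False by (cases y) auto
    then have "y = [r]" using cover_ball.root_unique[OF ball_seq n] by blast
    then show ?thesis by simp
  qed
qed

end

section \<open>Triviality of the cover and the resulting level function\<close>

locale null_graph = c45_free_graph adj for adj :: "'v \<Rightarrow> 'v \<Rightarrow> bool" +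
  assumes loops_null: "\<lbrakk>c m = c 0; \<forall>i<m. near (c i) (c (Suc i))\<rbrakk> \<Longrightarrow> grid_null c m"
begin

lemma cov_inj: assumes "u \<in> cov_nodes r" "w \<in> cov_nodes r" "hd u = hd w" shows "u = w"
proof (rule cov.inj_if_null[where r = r and ?y0.0 = "[r]"])
  show "grid_null c m" if "c 0 = hd [r]" "c m = hd [r]" "\<forall>i<m. near (c i) (c (Suc i))" for c m
    by (rule loops_null) (use that in simp_all)
qed (use assms cov_root cov_conn in simp_all)

lemma surj_lift: assumes "adj\<^sup>*\<^sup>* r x" shows "\<exists>y\<in>cov_nodes r. hd y = x"
  using assms
proof induction
  case base then show ?case using cov_root by force
next
  case (step y z) then show ?case using cov.cov_surj cov.cov_in by blast
qed

text \<open>Well defined on the component of \<open>r\<close> by \<open>cov_inj\<close> and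
  \<open>surj_lift\<close>; for systolic complexes it turns out to be the distance from
  \<open>r\<close>.\<close>

definition cover_level :: "'v \<Rightarrow> 'v \<Rightarrow> nat" where
  "cover_level r x = length (THE y. y \<in> cov_nodes r \<and> hd y = x) - 1"

lemma cover_level: assumes "y \<in> cov_nodes r" shows "Suc (cover_level r (hd y)) = length y"
proof -
  have "(THE y'. y' \<in> cov_nodes r \<and> hd y' = hd y) = y" using assms cov_inj by blast
  moreover have "y \<noteq> []" using assms cover_ball.nonempty[OF ball_seq] by (auto simp: cov_nodes_def)
  ultimately show ?thesis by (simp add: cover_level_def)
qed

lemma cover_level_root: "cover_level r r = 0" using cover_level[OF cov_root, of r] by simp

lemma cover_level_adj: assumes "adj\<^sup>*\<^sup>* r x" "adj x y" shows "cover_level r y \<le> Suc (cover_level r x)"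
proof -
  obtain u where u: "u \<in> cov_nodes r" "hd u = x" using surj_lift assms by blast
  then obtain w where w: "cov_edge r u w" "hd w = y" using cov.cov_surj assms(2) by blast
  then show ?thesis using cov_level[OF cov.cov_sym[OF w(1)]] cover_level[OF u(1)] cover_level[OF cov.cov_in[OF w(1)]] u by auto
qed

lemma cover_level_down: assumes "adj\<^sup>*\<^sup>* r x" "x \<noteq> r" shows "\<exists>y. adj x y \<and> cover_level r x = Suc (cover_level r y)"
proof -
  obtain u where u: "u \<in> cov_nodes r" "hd u = x" using surj_lift assms by blast
  have "Suc 0 < length u"
  proof (rule ccontr)
    assume "\<not> Suc 0 < length u"
    moreover obtain n where n: "u \<in> fst (ball_seq r n)" using u by (auto simp: cov_nodes_def)
    ultimately have "u = [r]" using cover_ball.root_unique[OF ball_seq n] cover_ball.nonempty[OF ball_seq n]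
      by (cases u) auto
    then show False using u assms by simp
  qed
  then obtain t where t: "cov_edge r u t" "length u = Suc (length t)" using cov_down u by blast
  then show ?thesis using cov.cov_adj[OF t(1)] cover_level[OF u(1)] cover_level[OF cov.cov_in[OF t(1)]] u by auto
qed

lemma cover_level_clique:
  assumes "adj\<^sup>*\<^sup>* r x" "adj x y" "adj x z" "cover_level r x = Suc (cover_level r y)" "cover_level r x = Suc (cover_level r z)" "y \<noteq> z"
  shows "adj y z"
proof -
  obtain u where u: "u \<in> cov_nodes r" "hd u = x" using surj_lift assms by blast
  then obtain v w where vw: "cov_edge r u v" "hd v = y" "cov_edge r u w" "hd w = z" using cov.cov_surj assms(2,3) by metis
  have "cov_edge r v w"
    using cov_clique[OF vw(1,3)] cover_level[OF u(1)] cover_level[OF cov.cov_in[OF vw(1)]] cover_level[OF cov.cov_in[OF vw(3)]] u vw assms by auto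
  then show ?thesis using cov.cov_adj vw by blast
qed

lemma cover_level_triangle:
  assumes "adj\<^sup>*\<^sup>* r x" "adj x y" "cover_level r x = cover_level r y"
  shows "\<exists>z. adj x z \<and> adj y z \<and> cover_level r x = Suc (cover_level r z)"
proof -
  obtain u where u: "u \<in> cov_nodes r" "hd u = x" using surj_lift assms by blast
  then obtain v where v: "cov_edge r u v" "hd v = y" using cov.cov_surj assms(2) by metis
  obtain t where t: "cov_edge r u t" "cov_edge r v t" "length u = Suc (length t)"
    using cov_triangle[OF v(1)] cover_level[OF u(1)] cover_level[OF cov.cov_in[OF v(1)]] u v assms by auto
  then show ?thesis
    using cov.cov_adj[OF t(1)] cov.cov_adj[OF t(2)] cover_level[OF u(1)] cover_level[OF cov.cov_in[OF t(1)]] u v by auto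
qed

end

section \<open>Contraction in bridged graphs without short induced cycles\<close>

context simple_graph begin

text \<open>Only interior vertices are confined to \<open>S\<close>, and steps may stall, so that
  joining and cutting paths needs no case distinctions.\<close>

definition near_path :: "'v set \<Rightarrow> nat \<Rightarrow> 'v \<Rightarrow> 'v \<Rightarrow> bool" where
  "near_path S k x y \<longleftrightarrow> (\<exists>f. f 0 = x \<and> f k = y \<and> (\<forall>i<k. near (f i) (f (Suc i))) \<and> (\<forall>i. 0 < i \<and> i < k \<longrightarrow> f i \<in> S))"

lemma near_path_cut:
  assumes f: "f 0 = x" "f k = y" "\<forall>i<k. near (f i) (f (Suc i))" "\<forall>i. 0 < i \<and> i < k \<longrightarrow> f i \<in> S"
    and ij: "i < j" "j \<le> k" "near (f i) (f j)"
  shows "near_path S (Suc i + (k - j)) x y"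
proof -
  define g where "g l = (if l \<le> i then f l else f (l + (j - Suc i)))" for l
  have "near (g l) (g (Suc l))" if "l < Suc i + (k - j)" for l
  proof -
    consider "l < i" | "l = i" | "l > i" by linarith
    then show ?thesis
    proof cases
      case 1 then show ?thesis using f ij by (simp add: g_def)
    next
      case 2 then show ?thesis using ij by (simp add: g_def)
    next
      case 3
      then have "near (f (l + (j - Suc i))) (f (Suc (l + (j - Suc i))))" using f(3) that ij by simp
      then show ?thesis using 3 by (simp add: g_def)
    qed
  qed
  moreover have "g l \<in> S" if "0 < l" "l < Suc i + (k - j)" for l
    using f(4) that ij by (auto simp: g_def)
  moreover have "g 0 = x" "g (Suc i + (k - j)) = y" using f ij by (auto simp: g_def)
  ultimately show ?thesis unfolding near_path_def by blast
qed

text \<open>A shortest such path admits no shortcut, hence has no chords and no repetitions. A stall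
  at the last step is excluded because \<open>y\<close> lies outside \<open>S\<close>.\<close>

lemma near_path_induced:
  assumes c: "near_path S k x y" and n: "\<not> near x y" and xy: "x \<notin> S" "y \<notin> S"
  obtains f p where "p \<le> k" "2 \<le> p" "f 0 = x" "f p = y" "\<forall>i<p. adj (f i) (f (Suc i))"
    "\<forall>i. 0 < i \<and> i < p \<longrightarrow> f i \<in> S" "inj_on f {..p}"
    "\<forall>i j. i < j \<and> j \<le> p \<and> adj (f i) (f j) \<longrightarrow> j = Suc i"
proof -
  define p where "p = (LEAST p. near_path S p x y)"
  have p: "near_path S p x y" unfolding p_def using c by (rule LeastI)
  have pmin: "p \<le> q" if "near_path S q x y" for q unfolding p_def using that by (rule Least_le)
  obtain f where f: "f 0 = x" "f p = y" "\<forall>i<p. near (f i) (f (Suc i))" "\<forall>i. 0 < i \<and> i < p \<longrightarrow> f i \<in> S"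
    using p unfolding near_path_def by blast
  have key: "j = Suc i" if "i < j" "j \<le> p" "near (f i) (f j)" for i j
  proof -
    have "p \<le> Suc i + (p - j)" using pmin near_path_cut[OF f that] by blast
    then show ?thesis using that by linarith
  qed
  have neq: "f i \<noteq> f j" if ij: "i < j" "j \<le> p" for i j
  proof
    assume e: "f i = f j"
    then have j: "j = Suc i" by (intro key) (use ij in auto)
    show False
    proof (cases "j < p")
      case True
      have "near (f j) (f (Suc j))" using f(3) True by blast
      then have "near (f i) (f (Suc j))" unfolding e .
      then have "Suc j = Suc i" by (intro key) (use ij True in auto)
      then show False using ij by simp
    next
      case False
      then have jp: "j = p" using ij by simp
      have "f i = y" using e f(2) jp by simp
      then have "i = 0" using f(4) xy(2) ij jp by (cases i) auto
      then show False using \<open>f i = y\<close> f(1) n by simp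
    qed
  qed
  have "p \<noteq> 0" using f(1,2) n near_refl by (intro notI) simp
  moreover have "p \<noteq> 1" using f(1,2) f(3)[rule_format, of 0] n by (intro notI) simp
  ultimately have "2 \<le> p" by simp
  moreover have "\<forall>i<p. adj (f i) (f (Suc i))"
  proof (intro allI impI)
    fix i assume "i < p"
    then have "f i \<noteq> f (Suc i)" "near (f i) (f (Suc i))" using neq[of i "Suc i"] f(3) by auto
    then show "adj (f i) (f (Suc i))" by (simp add: near_def)
  qed
  moreover have "inj_on f {..p}"
  proof (rule inj_onI, rule ccontr)
    fix i j assume "i \<in> {..p}" "j \<in> {..p}" "f i = f j" "i \<noteq> j"
    then show False using neq[of i j] neq[of j i] by (cases "i < j") auto
  qed
  moreover have "\<forall>i j. i < j \<and> j \<le> p \<and> adj (f i) (f j) \<longrightarrow> j = Suc i" using key by (simp add: near_def)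
  moreover have "p \<le> k" using pmin c .
  ultimately show thesis using that[of p f] f(1,2,4) by blast
qed

end

locale large_graph = simple_graph adj for adj :: "'v \<Rightarrow> 'v \<Rightarrow> bool" +
  assumes diagonal: "\<And>n c. \<lbrakk>4 \<le> n; n < 18; inj_on c {..<n}; \<forall>i<n. adj (c i) (c (Suc i mod n))\<rbrakk> \<Longrightarrow>
    \<exists>i<n. \<exists>j<n. i \<noteq> j \<and> j \<noteq> Suc i mod n \<and> i \<noteq> Suc j mod n \<and> adj (c i) (c j)"
begin

text \<open>Two chordless paths with the same ends, through separated sets, would close up to a short
  cycle without diagonal.\<close>

lemma near_if_two_sided:
  assumes c: "near_path U p z z'" "near_path L q z z'" "p + q < 18"
    and nz: "z \<notin> U" "z' \<notin> U" "z \<notin> L" "z' \<notin> L"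
    and UL: "\<And>u l. u \<in> U \<Longrightarrow> l \<in> L \<Longrightarrow> \<not> near u l"
  shows "near z z'"
proof (rule ccontr)
  assume n: "\<not> near z z'"
  obtain f p' where f: "p' \<le> p" "2 \<le> p'" "f 0 = z" "f p' = z'" "\<forall>i<p'. adj (f i) (f (Suc i))"
    "\<forall>i. 0 < i \<and> i < p' \<longrightarrow> f i \<in> U" "inj_on f {..p'}"
    "\<forall>i j. i < j \<and> j \<le> p' \<and> adj (f i) (f j) \<longrightarrow> j = Suc i"
    using near_path_induced[OF c(1) n nz(1,2)] by metis
  obtain g q' where g: "q' \<le> q" "2 \<le> q'" "g 0 = z" "g q' = z'" "\<forall>i<q'. adj (g i) (g (Suc i))"
    "\<forall>i. 0 < i \<and> i < q' \<longrightarrow> g i \<in> L" "inj_on g {..q'}"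
    "\<forall>i j. i < j \<and> j \<le> q' \<and> adj (g i) (g j) \<longrightarrow> j = Suc i"
    using near_path_induced[OF c(2) n nz(3,4)] by metis
  \<comment> \<open>Both paths have at least two edges, so the cycle that runs along
    \<open>f\<close> and back along \<open>g\<close> has length between 4 and 17.\<close>
  define N where "N = p' + q'"
  define h where "h i = (if i \<le> p' then f i else g (N - i))" for i
  have N: "4 \<le> N" "N < 18" using f(1,2) g(1,2) c(3) by (auto simp: N_def)
  have hL: "h i \<in> L" "0 < N - i" "N - i < q'" if "p' < i" "i < N" for i
    using that g(6) by (auto simp: h_def N_def)
  have hp: "h i = g (N - i)" if "p' \<le> i" "i < N" for i using that f(4) g(4) by (auto simp: h_def N_def)
  have mixed: "\<not> near (h i) (h j)" if "0 < i" "i < p'" "p' < j" "j < N" for i j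
    using UL[of "h i" "h j"] hL(1)[of j] that f(6) by (simp add: h_def)
  have inj: "h i \<noteq> h j" if ij: "i < j" "j < N" for i j
  proof -
    consider "j \<le> p'" | "p' \<le> i" | "0 < i" "i < p'" "p' < j" | "i = 0" "p' < j" using ij by linarith
    then show ?thesis
    proof cases
      case 1 then show ?thesis using f(7) ij by (auto simp: h_def inj_on_def)
    next
      case 2
      then have "N - i \<noteq> N - j" "N - i \<le> q'" "N - j \<le> q'" using ij by (auto simp: N_def)
      then show ?thesis using g(7) hp[of i] hp[of j] 2 ij unfolding inj_on_def by (metis atMost_iff le_trans less_imp_le less_trans)
    next
      case 3 then show ?thesis using mixed[of i j] ij by auto
    next
      case 4 then show ?thesis using hL(1)[of j] ij nz f(3) by (auto simp: h_def)
    qed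
  qed
  have "inj_on h {..<N}"
  proof (rule inj_onI, rule ccontr)
    fix i j assume "i \<in> {..<N}" "j \<in> {..<N}" "h i = h j" "i \<noteq> j"
    then show False using inj[of i j] inj[of j i] by (cases "i < j") auto
  qed
  moreover have "adj (h i) (h (Suc i mod N))" if i: "i < N" for i
  proof -
    consider "i < p'" | "p' \<le> i" "Suc i < N" | "p' \<le> i" "Suc i = N" using i by linarith
    then show ?thesis
    proof cases
      case 1 then show ?thesis using f(5) g(2) by (simp add: h_def N_def)
    next
      case 2
      have e: "N - i = Suc (N - Suc i)" using i by simp
      have lt: "N - Suc i < q'" using 2 g(2) by (auto simp: N_def)
      have "adj (g (N - i)) (g (N - Suc i))" unfolding e by (rule adj_sym) (use g(5) lt in blast)
      then show ?thesis using hp[of i] hp[of "Suc i"] 2 by simp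
    next
      case 3
      have "adj (g (Suc 0)) (g 0)" using g(2,5) adj_sym by simp
      moreover have "N - i = Suc 0" using 3 by simp
      ultimately show ?thesis using 3 hp[of i] g(3) f(3) by (simp add: h_def)
    qed
  qed
  ultimately obtain i j where ij: "i < N" "j < N" "i \<noteq> j" "j \<noteq> Suc i mod N" "i \<noteq> Suc j mod N" "adj (h i) (h j)"
    using diagonal[OF N] by blast
  have no: False if a: "i < j" "j < N" "j \<noteq> Suc i" "i \<noteq> Suc j mod N" "adj (h i) (h j)" for i j
  proof -
    consider "j \<le> p'" | "p' \<le> i" | "0 < i" "i < p'" "p' < j" | "i = 0" "p' < j" using a by linarith
    then show False
    proof cases
      case 1 then show False using f(8) a by (auto simp: h_def)
    next
      case 2
      have "adj (g (N - j)) (g (N - i))" using hp[of i] hp[of j] 2 a adj_sym by simp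
      moreover have "N - j < N - i" "N - i \<le> q'" using 2 a by (auto simp: N_def)
      ultimately have "N - i = Suc (N - j)" using g(8) by blast
      then show False using a by linarith
    next
      case 3 then show False using mixed[of i j] a by (auto simp: near_def)
    next
      case 4
      then have "adj (g 0) (g (N - j))" using hp[of j] a g(3) f(3) by (simp add: h_def)
      moreover have "0 < N - j" "N - j \<le> q'" using 4 a by (auto simp: N_def)
      ultimately have "N - j = Suc 0" using g(8) by blast
      then have "Suc j = N" using a by linarith
      then show False using a 4 by simp
    qed
  qed
  show False
  proof (cases "i < j")
    case True
    then show False using no[of i j] ij by auto
  next
    case False
    then show False using no[of j i] ij adj_sym by auto
  qed
qed

text \<open>A 4- or 5-cycle without diagonal falls at \<open>a\<close> and \<open>c\<close> into two
  paths with separated interiors, as required by \<open>near_if_two_sided\<close>.\<close>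

sublocale c45_free_graph
proof unfold_locales
  fix a b c d assume a: "adj a b" "adj b c" "adj c d" "adj d a" "a \<noteq> c" "b \<noteq> d"
  show "adj a c \<or> adj b d"
  proof (rule ccontr)
    assume n: "\<not> ?thesis"
    have 1: "near_path {b} 2 a c" unfolding near_path_def
      by (rule exI[of _ "(!) [a, b, c]"]) (use a in \<open>auto simp: near_def less_2_cases_iff\<close>)
    have 2: "near_path {d} 2 a c" unfolding near_path_def
      by (rule exI[of _ "(!) [a, d, c]"]) (use a(3,4)[THEN adj_sym] in \<open>auto simp: near_def less_2_cases_iff\<close>)
    have "a \<noteq> b" "a \<noteq> d" "c \<noteq> b" "c \<noteq> d" using a adj_irrefl by blast+
    then have "near a c"
      using near_if_two_sided[OF 1 2] a n by (simp add: near_def)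
    then show False using n a by (simp add: near_def)
  qed
next
  fix a b c d e assume a: "adj a b" "adj b c" "adj c d" "adj d e" "adj e a" "a \<noteq> c" "a \<noteq> d" "b \<noteq> d" "b \<noteq> e" "c \<noteq> e"
  show "adj a c \<or> adj a d \<or> adj b d \<or> adj b e \<or> adj c e"
  proof (rule ccontr)
    assume n: "\<not> ?thesis"
    have 1: "near_path {b} 2 a c" unfolding near_path_def
      by (rule exI[of _ "(!) [a, b, c]"]) (use a in \<open>auto simp: near_def less_2_cases_iff\<close>)
    have 2: "near_path {d, e} 3 a c" unfolding near_path_def
      by (rule exI[of _ "(!) [a, e, d, c]"])
        (use a(3-5)[THEN adj_sym] in \<open>auto simp: near_def numeral_3_eq_3 less_Suc_eq\<close>)
    have "a \<noteq> b" "a \<noteq> e" "c \<noteq> b" "c \<noteq> d" using a adj_irrefl by blast+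
    then have "near a c"
      using near_if_two_sided[OF 1 2] a n by (auto simp: near_def)
    then show False using n a by (simp add: near_def)
  qed
qed

end

section \<open>Slices of geodesics and paths within spheres\<close>

locale bridged_graph = large_graph adj for adj :: "'v \<Rightarrow> 'v \<Rightarrow> bool" +
  fixes V :: "'v set" and d :: "'v \<Rightarrow> 'v \<Rightarrow> nat"
  assumes adj_V: "adj x y \<Longrightarrow> x \<in> V"
    and d_0: "\<lbrakk>x \<in> V; y \<in> V\<rbrakk> \<Longrightarrow> d x y = 0 \<longleftrightarrow> x = y"
    and d_1: "\<lbrakk>x \<in> V; y \<in> V\<rbrakk> \<Longrightarrow> d x y = Suc 0 \<longleftrightarrow> adj x y"
    and d_sym: "\<lbrakk>x \<in> V; y \<in> V\<rbrakk> \<Longrightarrow> d x y = d y x"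
    and d_triangle: "\<lbrakk>x \<in> V; y \<in> V; z \<in> V\<rbrakk> \<Longrightarrow> d x z \<le> d x y + d y z"
    and d_step: "\<lbrakk>x \<in> V; y \<in> V; d x y = Suc n\<rbrakk> \<Longrightarrow> \<exists>z. adj x z \<and> d z y = n"
    and down_clique: "\<lbrakk>r \<in> V; adj x y; adj x z; d r x = Suc (d r y); d r x = Suc (d r z)\<rbrakk> \<Longrightarrow> near y z"
    and down_triangle: "\<lbrakk>r \<in> V; adj x y; d r x = d r y\<rbrakk> \<Longrightarrow> \<exists>z. adj x z \<and> adj y z \<and> d r x = Suc (d r z)"
begin

lemma adj_V2: "adj x y \<Longrightarrow> y \<in> V" using adj_V adj_sym by blast

lemma near_V: "near x y \<Longrightarrow> x \<in> V \<Longrightarrow> y \<in> V" using adj_V2 by (auto simp: near_def)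

lemma near_d: "\<lbrakk>x \<in> V; y \<in> V\<rbrakk> \<Longrightarrow> near x y \<longleftrightarrow> d x y \<le> Suc 0"
  using d_0[of x y] d_1[of x y] by (auto simp: near_def le_Suc_eq)

lemma d_self [simp]: "x \<in> V \<Longrightarrow> d x x = 0" using d_0 by blast

lemma d_near_le: "\<lbrakk>r \<in> V; x \<in> V; near x y\<rbrakk> \<Longrightarrow> d r y \<le> Suc (d r x)"
  using d_triangle[of r x y] near_d[of x y] near_V[of x y] by auto

text \<open>The slice at height \<open>n\<close> of the metric interval between \<open>r\<close> and
  \<open>u\<close>.\<close>

definition on_geodesic :: "'v \<Rightarrow> nat \<Rightarrow> 'v \<Rightarrow> 'v \<Rightarrow> bool" where
  "on_geodesic r n u s \<longleftrightarrow> s \<in> V \<and> d r s = n \<and> n + d s u = d r u"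

lemma on_geodesic_D: "on_geodesic r n u s \<Longrightarrow> s \<in> V" "on_geodesic r n u s \<Longrightarrow> d r s = n" "on_geodesic r n u s \<Longrightarrow> n + d s u = d r u"
  by (auto simp: on_geodesic_def)

lemma on_geodesic_self: "\<lbrakk>r \<in> V; u \<in> V; on_geodesic r (d r u) u s\<rbrakk> \<Longrightarrow> s = u"
  using d_0 by (auto simp: on_geodesic_def)

lemma on_geodesic_adj: "\<lbrakk>r \<in> V; adj u w; d r u = Suc (d r w)\<rbrakk> \<Longrightarrow> on_geodesic r (d r w) u w"
  using adj_V2[of u w] adj_V[of u w] d_1[of w u] adj_sym[of u w] by (auto simp: on_geodesic_def)

lemma on_geodesic_trans:
  assumes "r \<in> V" "u \<in> V" "on_geodesic r m u y" "on_geodesic r n y s" shows "on_geodesic r n u s"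
  using assms d_triangle[of s y u] d_triangle[of r s u] by (auto simp: on_geodesic_def)

lemma on_geodesic_ex: assumes "r \<in> V" "u \<in> V" "n \<le> d r u" shows "\<exists>s. on_geodesic r n u s"
  using assms(2,3)
proof (induction "d r u - n" arbitrary: u)
  case 0
  then have "on_geodesic r n u u" by (auto simp: on_geodesic_def)
  then show ?case ..
next
  case (Suc k)
  then have "d u r = Suc (d r u - 1)" using d_sym[OF assms(1) Suc(3)] by simp
  then obtain w where w: "adj u w" "d w r = d r u - 1" using d_step[OF Suc(3) assms(1)] by blast
  have wV: "w \<in> V" using w adj_V2 by blast
  then have dw: "d r u = Suc (d r w)" using w d_sym[OF wV assms(1)] Suc(2) by simp
  have "n \<le> d r w" "k = d r w - n" using Suc(2,4) dw by linarith+
  then obtain s where "on_geodesic r n w s" using Suc(1)[of w] wV by blast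
  then have "on_geodesic r n u s" using on_geodesic_trans[OF assms(1) Suc(3) on_geodesic_adj[OF assms(1) w(1) dw]] by blast
  then show ?case ..
qed

lemma on_geodesic_up: assumes "r \<in> V" "u \<in> V" "on_geodesic r n u s" "n < d r u" shows "\<exists>y. on_geodesic r (Suc n) u y \<and> adj y s"
proof -
  have "d s u = Suc (d s u - 1)" using assms(3,4) by (auto simp: on_geodesic_def)
  then obtain y where y: "adj s y" "d y u = d s u - 1" using d_step[of s u] assms by (metis on_geodesic_D(1))
  have "y \<in> V" using y adj_V2 by blast
  then have "on_geodesic r (Suc n) u y"
    using y assms d_near_le[of r s y] d_triangle[of r y u] by (auto simp: on_geodesic_def near_def)
  then show ?thesis using y adj_sym by blast
qed

text \<open>Paths in a sphere about \<open>r\<close>. Steps may stall, so lengths can be padded. For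
  \<open>h = 0\<close> nothing places the point on the sphere, which therefore appears as a separate
  hypothesis below.\<close>

definition horizontal :: "'v \<Rightarrow> nat \<Rightarrow> nat \<Rightarrow> 'v \<Rightarrow> 'v \<Rightarrow> bool" where
  "horizontal r m h = (\<lambda>x y. near x y \<and> x \<in> V \<and> y \<in> V \<and> d r x = m \<and> d r y = m) ^^ h"

lemma horizontal_0 [simp]: "horizontal r m 0 x y \<longleftrightarrow> x = y" by (simp add: horizontal_def)

lemma horizontal_Suc: "horizontal r m (Suc h) x y \<longleftrightarrow> (\<exists>z. horizontal r m h x z \<and> near z y \<and> z \<in> V \<and> y \<in> V \<and> d r z = m \<and> d r y = m)"
  by (auto simp: horizontal_def)

lemma horizontal_1: "\<lbrakk>near x y; x \<in> V; d r x = m; d r y = m\<rbrakk> \<Longrightarrow> horizontal r m (Suc 0) x y"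
  using near_V by (auto simp: horizontal_Suc)

lemma horizontal_add: "horizontal r m h x y \<Longrightarrow> horizontal r m k y z \<Longrightarrow> horizontal r m (h + k) x z"
  unfolding horizontal_def relpowp_add by blast

lemma horizontal_conn:
  assumes h: "horizontal r m h u v" and u: "u \<in> S" "v \<in> S" and S: "\<And>x. x \<in> V \<Longrightarrow> d r x = m \<Longrightarrow> x \<in> S"
    and n: "near s u" "near v t"
  shows "near_path S (h + 2) s t"
proof -
  obtain f where f: "f 0 = u" "f h = v" "\<forall>i<h. near (f i) (f (Suc i)) \<and> f i \<in> V \<and> f (Suc i) \<in> V \<and> d r (f i) = m \<and> d r (f (Suc i)) = m"
    using h unfolding horizontal_def relpowp_fun_conv by blast
  define g where "g i = (if i = 0 then s else if i \<le> Suc h then f (i - 1) else t)" for i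
  have "near (g i) (g (Suc i))" if ih: "i < h + 2" for i
  proof -
    consider "i = 0" | "0 < i" "i < Suc h" | "i = Suc h" using ih by linarith
    then show ?thesis
    proof cases
      case 2
      then obtain j where "i = Suc j" "j < h" by (cases i) auto
      then show ?thesis using f by (simp add: g_def)
    qed (use f n in \<open>auto simp: g_def\<close>)
  qed
  moreover have "g i \<in> S" if "0 < i" "i < h + 2" for i
  proof -
    obtain j where j: "i = Suc j" "j \<le> h" using \<open>0 < i\<close> \<open>i < h + 2\<close> by (cases i) auto
    have "f j \<in> S" using f u S j(2) by (cases "j = h") auto
    then show ?thesis using j by (simp add: g_def)
  qed
  moreover have "g 0 = s" "g (h + 2) = t" by (auto simp: g_def)
  ultimately show ?thesis unfolding near_path_def by blast
qed

text \<open>The ends of each edge have a common lower neighbour, and lower neighbours of one vertex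
  are near each other. So \<open>h\<close> edges descend to a path through \<open>h\<close> new
  points between the prescribed ends \<open>s\<close> and \<open>t\<close>: one step longer,
  whichever lower neighbours are chosen.\<close>

lemma horizontal_down:
  assumes "r \<in> V" "horizontal r (Suc n) h u v" "d r u = Suc n" "adj u s" "d r s = n" "adj v t" "d r t = n" "d r v = Suc n"
  shows "horizontal r n (Suc h) s t"
  using assms(2,6-8)
proof (induction h arbitrary: v t)
  case 0
  then have "near s t" using down_clique[OF assms(1,4), of t] assms by simp
  then show ?case using assms adj_V2 0 by (intro horizontal_1) auto
next
  case (Suc h)
  then obtain w where w: "horizontal r (Suc n) h u w" "near w v" "w \<in> V" "d r w = Suc n" by (auto simp: horizontal_Suc)
  have "\<exists>q. adj w q \<and> adj v q \<and> d r q = n"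
  proof (cases "w = v")
    case True then show ?thesis using Suc.prems by blast
  next
    case False
    then show ?thesis using down_triangle[OF assms(1), of w v] w Suc.prems by (auto simp: near_def)
  qed
  then obtain q where q: "adj w q" "adj v q" "d r q = n" by blast
  have "horizontal r n (Suc h) s q" using Suc.IH[OF w(1) q(1,3) w(4)] .
  moreover have "near q t" using down_clique[OF assms(1) q(2) Suc.prems(2)] Suc.prems q by simp
  ultimately show ?case using q Suc.prems adj_V2 by (subst horizontal_Suc) blast
qed

text \<open>Through the sphere above, \<open>s\<close> and \<open>t\<close> are joined by
  \<open>h + 2\<close> steps; descending twice joins them through the sphere below by
  \<open>h + 4\<close> steps. Those spheres are two levels apart, hence separated, and the total
  \<open>2 * h + 6\<close> is at most 16.\<close>

lemma contraction:
  assumes r: "r \<in> V" and h: "horizontal r (Suc n) h u v" "h \<le> 5" and u: "d r u = Suc n" "adj u s" "d r s = n"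
    and v: "d r v = Suc n" "adj v t" "d r t = n"
  shows "near s t"
proof (cases n)
  case 0
  then have "s = r" "t = r" using d_0[OF r] u v adj_V2 by metis+
  then show ?thesis by simp
next
  case (Suc k)
  have V: "s \<in> V" "t \<in> V" "u \<in> V" "v \<in> V" using u v adj_V adj_V2 by blast+
  have low: "horizontal r n (Suc h) s t" using horizontal_down[OF r h(1) u v(2,3,1)] .
  obtain a where a: "adj s a" "d r a = k"
    using d_step[OF V(1) r] d_sym[OF V(1) r] d_sym[OF r] u(3) Suc adj_V2 by metis
  obtain b where b: "adj t b" "d r b = k"
    using d_step[OF V(2) r] d_sym[OF V(2) r] d_sym[OF r] v(3) Suc adj_V2 by metis
  have low2: "horizontal r k (Suc (Suc h)) a b"
    using horizontal_down[OF r low[unfolded Suc] _ a b] u v Suc by simp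
  define U where "U = {x \<in> V. d r x = Suc n}"
  define L where "L = {x \<in> V. d r x = k}"
  have U: "near_path U (h + 2) s t"
    by (rule horizontal_conn[OF h(1)]) (use V u v adj_sym in \<open>auto simp: U_def near_def\<close>)
  have L: "near_path L (Suc (Suc h) + 2) s t"
    by (rule horizontal_conn[OF low2]) (use V a b adj_V2 adj_sym in \<open>auto simp: L_def near_def\<close>)
  show ?thesis
  proof (rule near_if_two_sided[OF U L])
    show "\<not> near x l" if "x \<in> U" "l \<in> L" for x l
      using d_near_le[OF r, of l x] near_sym[of x l] that Suc by (auto simp: U_def L_def)
  qed (use h u v Suc in \<open>auto simp: U_def L_def\<close>)
qed

text \<open>The first descent contracts any horizontal distance up to five to at most one, and from
  then on \<open>contraction\<close> keeps it there.\<close>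

lemma horizontal_slices_near:
  assumes r: "r \<in> V" and h: "horizontal r m h u v" "h \<le> 5" and V: "u \<in> V" "d r u = m" "v \<in> V" "d r v = m" and "n < m"
    and st: "on_geodesic r n u s" "on_geodesic r n v t"
  shows "near s t"
  using \<open>n < m\<close> st
proof (induction "m - n" arbitrary: n s t)
  case (Suc k)
  obtain y where y: "on_geodesic r (Suc n) u y" "adj y s" using on_geodesic_up[OF r V(1) Suc(4)] Suc(3) V by auto
  obtain z where z: "on_geodesic r (Suc n) v z" "adj z t" using on_geodesic_up[OF r V(3) Suc(5)] Suc(3) V by auto
  have "\<exists>h\<le>5. horizontal r (Suc n) h y z"
  proof (cases "Suc n = m")
    case True
    then have "y = u" "z = v" using on_geodesic_self[OF r V(1)] on_geodesic_self[OF r V(3)] y z V by auto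
    then show ?thesis using h True by auto
  next
    case False
    then have "near y z" using Suc(1)[OF _ _ y(1) z(1)] Suc(2,3) by simp
    then have "horizontal r (Suc n) (Suc 0) y z" using y z by (intro horizontal_1) (auto simp: on_geodesic_def)
    then show ?thesis by (intro exI[of _ "Suc 0"]) simp
  qed
  then show ?case using contraction[OF r _ _ _ y(2) _ _ z(2)] on_geodesic_D y(1) z(1) Suc(4,5) by metis
qed simp

lemma on_geodesic_clique: "\<lbrakk>r \<in> V; u \<in> V; n < d r u; on_geodesic r n u s; on_geodesic r n u t\<rbrakk> \<Longrightarrow> near s t"
  using horizontal_slices_near[of r "d r u" 0 u u n s t] by simp

text \<open>The given \<open>s'\<close>, \<open>t'\<close> need not lie just above \<open>s\<close>,
  \<open>t\<close>. Slices being cliques, passing to the points that do costs one step at each end,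
  and \<open>3 + 2\<close> is still within the reach of \<open>contraction\<close>.\<close>

lemma on_geodesic_thick:
  assumes r: "r \<in> V" "x \<in> V" "y \<in> V" and st: "on_geodesic r (Suc n) x s'" "on_geodesic r (Suc n) y t'" "horizontal r (Suc n) h s' t'" "h \<le> 3"
    and n: "Suc n < d r x" "Suc n < d r y" and s: "on_geodesic r n x s" "on_geodesic r n y t"
  shows "near s t"
proof -
  obtain a where a: "on_geodesic r (Suc n) x a" "adj a s" using on_geodesic_up[OF r(1,2) s(1)] n by auto
  obtain b where b: "on_geodesic r (Suc n) y b" "adj b t" using on_geodesic_up[OF r(1,3) s(2)] n by auto
  have 1: "horizontal r (Suc n) (Suc 0) a s'"
    using on_geodesic_clique[OF r(1,2) n(1) a(1) st(1)] a st by (intro horizontal_1) (auto simp: on_geodesic_def)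
  have 2: "horizontal r (Suc n) (Suc 0) t' b"
    using on_geodesic_clique[OF r(1,3) n(2) st(2) b(1)] b st by (intro horizontal_1) (auto simp: on_geodesic_def)
  have "horizontal r (Suc n) (Suc 0 + h + Suc 0) a b" using horizontal_add[OF horizontal_add[OF 1 st(3)] 2] .
  then show ?thesis
    using contraction[OF r(1) _ _ _ a(2) _ _ b(2), of n "Suc 0 + h + Suc 0"] a b s st(4) by (auto simp: on_geodesic_def)
qed

text \<open>The two claims are proved together because a horizontal first edge of a geodesic from \<open>x\<close> to
  \<open>y\<close> turns one into the other.\<close>

lemma on_geodesic_close:
  assumes r: "r \<in> V"
  shows "\<lbrakk>x \<in> V; y \<in> V; d x y = D\<rbrakk> \<Longrightarrow>
    (2 * n + 2 + d x y \<le> d r x + d r y \<longrightarrow> (\<exists>s t. on_geodesic r n x s \<and> on_geodesic r n y t \<and> horizontal r n 2 s t)) \<and>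
    (2 * n + 3 + d x y \<le> d r x + d r y \<longrightarrow> (\<exists>s t. on_geodesic r n x s \<and> on_geodesic r n y t \<and> horizontal r n (Suc 0) s t))"
proof (induction D arbitrary: x n)
  case 0
  then have xy: "x = y" using d_0 by blast
  show ?case
  proof (cases "n \<le> d r x")
    case True
    then obtain s where s: "on_geodesic r n x s" using on_geodesic_ex r 0 by blast
    have "horizontal r n (Suc 0) s s" using s by (intro horizontal_1) (auto simp: on_geodesic_def)
    moreover have "horizontal r n 2 s s" using horizontal_add[OF calculation calculation] by (simp add: numeral_2_eq_2)
    ultimately show ?thesis using s xy by blast
  next
    case False then show ?thesis using xy by simp
  qed
next
  case (Suc D)
  obtain x' where x': "adj x x'" "d x' y = D" using d_step[OF Suc.prems] by blast
  have x'V: "x' \<in> V" using x' adj_V2 by blast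
  have tri: "d r y \<le> d r x + Suc D" "d r x \<le> d r y + Suc D"
    using d_triangle[OF r Suc.prems(1,2)] d_triangle[OF r Suc.prems(2,1)] d_sym[OF Suc.prems(1,2)] Suc.prems(3) by auto
  note IH = Suc.IH[OF x'V Suc.prems(2) x'(2)]
  have cover_level: "d r x' \<le> Suc (d r x)" "d r x \<le> Suc (d r x')"
    using d_near_le[OF r, of x x'] d_near_le[OF r, of x' x] x' x'V Suc.prems near_sym[of x x'] by (auto simp: near_def)
  then consider "d r x = Suc (d r x')" | "d r x = d r x'" | "d r x' = Suc (d r x)" by linarith
  then show ?case
  proof cases
    case 1
    have "on_geodesic r n x s" if "on_geodesic r n x' s" for n s
      using on_geodesic_trans[OF r Suc.prems(1) on_geodesic_adj[OF r x'(1) 1] that] .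
    then show ?thesis using IH[of n] 1 x' Suc.prems by (auto; blast)
  next
    case 3
    have sub: "on_geodesic r n x' s" if "on_geodesic r n x s" for n s
      using on_geodesic_trans[OF r x'V on_geodesic_adj[OF r adj_sym[OF x'(1)] 3] that] .
    have ex: "\<exists>s t. on_geodesic r n x s \<and> on_geodesic r n y t \<and> near s t" if g: "2 * n + 2 + d x y \<le> d r x + d r y"
    proof -
      \<comment> \<open>The edge raises the radius and shortens the distance to \<open>y\<close>, so
        the slack grows by two and pays for the first claim one sphere higher;
        \<open>on_geodesic_thick\<close> brings it down again.\<close>
      have "2 * Suc n + 2 + d x' y \<le> d r x' + d r y" using g 3 x' Suc.prems by simp
      then obtain s' t' where s': "on_geodesic r (Suc n) x' s'" "on_geodesic r (Suc n) y t'" "horizontal r (Suc n) 2 s' t'"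
        using IH[of "Suc n"] by blast
      have "d r x' \<le> d r y + D"
        using d_triangle[OF r Suc.prems(2) x'V] d_sym[OF Suc.prems(2) x'V] x'(2) by simp
      then have n: "n \<le> d r x" "Suc n < d r x'" "n \<le> d r y" "Suc n < d r y" using g tri 3 Suc.prems by auto
      obtain s t where st: "on_geodesic r n x s" "on_geodesic r n y t" using on_geodesic_ex r Suc.prems n by metis
      have "near s t" using on_geodesic_thick[OF r x'V Suc.prems(2) s' _ n(2,4) sub[OF st(1)] st(2)] by simp
      then show ?thesis using st by blast
    qed
    have hh: "horizontal r n (Suc 0) s t \<and> horizontal r n 2 s t" if "on_geodesic r n x s" "on_geodesic r n y t" "near s t" for s t
    proof -
      have 1: "horizontal r n (Suc 0) s t" using that by (intro horizontal_1) (auto simp: on_geodesic_def)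
      have "horizontal r n (Suc 0) t t" using that by (intro horizontal_1) (auto simp: on_geodesic_def)
      then show ?thesis using horizontal_add[OF 1, of "Suc 0" t] 1 by (simp add: numeral_2_eq_2)
    qed
    show ?thesis
    proof (intro conjI impI)
      assume "2 * n + 2 + d x y \<le> d r x + d r y"
      then show "\<exists>s t. on_geodesic r n x s \<and> on_geodesic r n y t \<and> horizontal r n 2 s t" using ex hh by blast
    next
      assume "2 * n + 3 + d x y \<le> d r x + d r y"
      then have "2 * n + 2 + d x y \<le> d r x + d r y" by simp
      then show "\<exists>s t. on_geodesic r n x s \<and> on_geodesic r n y t \<and> horizontal r n (Suc 0) s t" using ex hh by blast
    qed
  next
    case 2
    have A: "\<exists>s t. on_geodesic r n x s \<and> on_geodesic r n y t \<and> horizontal r n 2 s t" if g: "2 * n + 2 + d x y \<le> d r x + d r y"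
    proof -
      \<comment> \<open>The horizontal edge only shortens the distance to \<open>y\<close>, which is
        just enough slack for the sharper second claim at \<open>x'\<close>. Changing from
        \<open>s'\<close> back to \<open>s\<close> uses up the second step.\<close>
      have "2 * n + 3 + d x' y \<le> d r x' + d r y" using g 2 x' Suc.prems by simp
      then obtain s' t where s': "on_geodesic r n x' s'" "on_geodesic r n y t" "horizontal r n (Suc 0) s' t"
        using IH[of n] by blast
      have n: "n < d r x" using g tri Suc.prems by auto
      obtain s where s: "on_geodesic r n x s" using on_geodesic_ex r Suc.prems n by (metis less_imp_le)
      have "near x x'" using x'(1) by (simp add: near_def)
      then have "horizontal r (d r x) (Suc 0) x x'" by (rule horizontal_1[OF _ Suc.prems(1) refl 2[symmetric]])
      then have "near s s'"
        by (rule horizontal_slices_near[OF r _ _ Suc.prems(1) refl x'V 2[symmetric] n s s'(1)]) simp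
      then have "horizontal r n (Suc 0) s s'" using on_geodesic_D[OF s] on_geodesic_D[OF s'(1)] by (intro horizontal_1)
      from horizontal_add[OF this s'(3)] have "horizontal r n 2 s t" by (simp add: numeral_2_eq_2)
      then show ?thesis using s s'(2) by blast
    qed
    have B: "\<exists>s t. on_geodesic r n x s \<and> on_geodesic r n y t \<and> horizontal r n (Suc 0) s t" if g: "2 * n + 3 + d x y \<le> d r x + d r y"
    proof -
      \<comment> \<open>Here the slack suffices for the first claim one sphere higher. A vertex
        \<open>w\<close> below both ends of the edge supplies a point \<open>s\<close> lying in the
        slices of \<open>x\<close> and of \<open>x'\<close>.\<close>
      have "2 * Suc n + 2 + d x' y \<le> d r x' + d r y" using g 2 x' Suc.prems by simp
      then obtain s' t' where s': "on_geodesic r (Suc n) x' s'" "on_geodesic r (Suc n) y t'" "horizontal r (Suc n) 2 s' t'"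
        using IH[of "Suc n"] by blast
      have n: "Suc n < d r x" "Suc n < d r y" using g tri Suc.prems by auto
      obtain w where w: "adj x w" "adj x' w" "d r x = Suc (d r w)" using down_triangle[OF r x'(1) 2] by blast
      obtain s where s: "on_geodesic r n w s" using on_geodesic_ex[OF r adj_V2[OF w(1)], of n] w n by auto
      have s1: "on_geodesic r n x s" using on_geodesic_trans[OF r Suc.prems(1) on_geodesic_adj[OF r w(1,3)] s] .
      have s2: "on_geodesic r n x' s" using on_geodesic_trans[OF r x'V on_geodesic_adj[OF r w(2)] s] w 2 by simp
      obtain t where t: "on_geodesic r n y t" using on_geodesic_ex[OF r Suc.prems(2), of n] n by auto
      have "near s t" using on_geodesic_thick[OF r x'V Suc.prems(2) s' _ _ n(2) s2 t] n 2 by simp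
      then have "horizontal r n (Suc 0) s t" using on_geodesic_D[OF s1] on_geodesic_D[OF t] by (intro horizontal_1)
      then show ?thesis using s1 t by blast
    qed
    show ?thesis using A B by blast
  qed
qed

text \<open>The assumption says that the Gromov product of \<open>x\<close> and \<open>y\<close> at \<open>r\<close> is at least \<open>n + 2\<close>.\<close>

lemma thin:
  assumes r: "r \<in> V" "x \<in> V" "y \<in> V" and n: "2 * n + 4 + d x y \<le> d r x + d r y" and s: "on_geodesic r n x s" "on_geodesic r n y t"
  shows "near s t"
proof -
  have "2 * Suc n + 2 + d x y \<le> d r x + d r y" using n by simp
  then obtain s' t' where s': "on_geodesic r (Suc n) x s'" "on_geodesic r (Suc n) y t'" "horizontal r (Suc n) 2 s' t'"
    using on_geodesic_close[OF r refl, of "Suc n"] by blast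
  have "Suc n < d r x" "Suc n < d r y"
    using d_triangle[OF r] d_triangle[OF r(1,3,2)] d_sym[OF r(2,3)] n by auto
  then show ?thesis using on_geodesic_thick[OF r s' _ _ _ s] by simp
qed

text \<open>Near points one sphere higher have a common lower neighbour, and it lies on geodesics to
  both. The extra sphere raises the 4 of \<open>thin\<close> to 6.\<close>

lemma thin_common:
  assumes r: "r \<in> V" "x \<in> V" "y \<in> V" and n: "2 * n + 6 + d x y \<le> d r x + d r y"
  shows "\<exists>s. on_geodesic r n x s \<and> on_geodesic r n y s"
proof -
  have l: "Suc n \<le> d r x" "Suc n \<le> d r y"
    using d_triangle[OF r] d_triangle[OF r(1,3,2)] d_sym[OF r(2,3)] n by auto
  obtain s t where st: "on_geodesic r (Suc n) x s" "on_geodesic r (Suc n) y t" using on_geodesic_ex[OF r(1,2) l(1)] on_geodesic_ex[OF r(1,3) l(2)] by blast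
  have "near s t" using thin[OF r _ st] n by simp
  then have "\<exists>z. near s z \<and> near t z \<and> z \<in> V \<and> d r z = n"
  proof (cases "s = t")
    case True
    obtain z where "on_geodesic r n s z" "d z s = Suc 0" using on_geodesic_ex[OF r(1), of s n] st by (auto simp: on_geodesic_def)
    then show ?thesis using True near_d d_sym st by (metis on_geodesic_D(1,2) le_refl)
  next
    case False
    then show ?thesis using down_triangle[OF r(1), of s t] st \<open>near s t\<close> adj_V2 by (fastforce simp: near_def on_geodesic_def)
  qed
  then obtain z where z: "near s z" "near t z" "z \<in> V" "d r z = n" by blast
  have "d s z \<le> Suc 0" "d t z \<le> Suc 0" using z near_d st on_geodesic_D(1) by blast+
  then have "on_geodesic r n s z" "on_geodesic r n t z"
    using z st d_sym[of s z] d_sym[of t z] d_triangle[of r z s] d_triangle[of r z t] r by (auto simp: on_geodesic_def)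
  then show ?thesis using on_geodesic_trans[OF r(1,2) st(1)] on_geodesic_trans[OF r(1,3) st(2)] by blast
qed

text \<open>Gromov's four-point condition. The slices of \<open>x\<close>, \<open>y\<close>,
  \<open>z\<close> at a common height \<open>n\<close> bound \<open>d x z\<close> by
  \<open>d r x + d r z - 2 * n + 2\<close>. The 7 consists of these 2, the 4 of \<open>thin\<close>,
  and 1 for rounding in the choice of \<open>n\<close>.\<close>

lemma four_point:
  assumes V: "r \<in> V" "x \<in> V" "y \<in> V" "z \<in> V"
  shows "d x z + d r y \<le> max (d x y + d r z) (d y z + d r x) + 7"
proof (rule ccontr)
  assume "\<not> ?thesis"
  then have a: "d x y + d r z + 8 \<le> d x z + d r y" "d y z + d r x + 8 \<le> d x z + d r y" by auto
  have xz: "d x z \<le> d r x + d r z" using d_triangle[OF V(2,1,4)] d_sym[OF V(1,2)] by simp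
  define n where "n = (min (d r x + d r y - d x y) (d r y + d r z - d y z) - 4) div 2"
  have m: "8 \<le> min (d r x + d r y - d x y) (d r y + d r z - d y z)" using a xz by auto
  have n: "2 * n + 4 + d x y \<le> d r x + d r y" "2 * n + 4 + d y z \<le> d r y + d r z" using m by (auto simp: n_def)
  have l: "n \<le> d r x" "n \<le> d r y" "n \<le> d r z"
    using n d_triangle[OF V(1,2,3)] d_triangle[OF V(1,3,2)] d_triangle[OF V(1,3,4)] d_triangle[OF V(1,4,3)]
      d_sym[OF V(2,3)] d_sym[OF V(3,4)] by auto
  obtain s t u where on_geodesic: "on_geodesic r n x s" "on_geodesic r n y t" "on_geodesic r n z u" using on_geodesic_ex V l by metis
  have "near s t" "near t u" using thin[OF V(1-3) n(1) on_geodesic(1,2)] thin[OF V(1,3,4) n(2) on_geodesic(2,3)] by auto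
  then have "d s t \<le> 1" "d t u \<le> 1" using near_d on_geodesic by (auto simp: on_geodesic_def)
  then have "d x z \<le> d s x + 2 + d u z"
    using d_triangle[of x s z] d_triangle[of s t z] d_triangle[of t u z] d_sym[of s x] V on_geodesic by (auto simp: on_geodesic_def)
  moreover have "d s x = d r x - n" "d u z = d r z - n" using on_geodesic by (auto simp: on_geodesic_def)
  ultimately show False using a m l unfolding n_def by linarith
qed

end

section \<open>Strongly rigid actions\<close>

context bridged_graph begin

text \<open>A defect of two would make \<open>u'\<close> the first step from \<open>u\<close>
  towards \<open>x\<close>, and a step away from \<open>x'\<close>. But the product of
  \<open>x\<close> and \<open>x'\<close> at \<open>u\<close> is large enough for a common first step
  \<open>v\<close>, which is near \<open>u'\<close>; so \<open>u'\<close> is no farther from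
  \<open>x'\<close> than \<open>u\<close>.\<close>

lemma near_defect:
  assumes V: "u \<in> V" "u' \<in> V" "x \<in> V" "x' \<in> V" and n: "near u u'" and far: "8 + d x x' \<le> d u x + d u x'"
  shows "d u x + d u' x' \<le> d u' x + d u x' + 1"
proof (rule ccontr)
  assume c: "\<not> ?thesis"
  have 1: "d u x \<le> Suc (d u' x)" "d u' x' \<le> Suc (d u x')"
    using d_near_le[of x u' u] d_near_le[of x' u u'] n near_sym[OF n] V d_sym by simp_all
  then have eq: "d u x = Suc (d u' x)" "d u' x' = Suc (d u x')" using c by auto
  then have "u \<noteq> u'" by auto
  then have "adj u u'" using n by (simp add: near_def)
  then have u': "on_geodesic u (Suc 0) x u'" using V eq d_1 by (simp add: on_geodesic_def)
  obtain v where v: "on_geodesic u (Suc 0) x v" "on_geodesic u (Suc 0) x' v" using thin_common[of u x x' "Suc 0"] V far by auto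
  have "near u' v" using on_geodesic_clique[OF V(1,3) _ u' v(1)] far V d_triangle[of u x x'] d_triangle[of u x' x] d_sym[of x x'] by simp
  then have "d u' x' \<le> Suc (d v x')"
    using d_near_le[of x' v u'] near_sym v V d_sym[of x'] by (auto simp: on_geodesic_def)
  then show False using eq v by (simp add: on_geodesic_def)
qed

text \<open>Reduces to \<open>near_defect\<close>: \<open>u\<close> lies on geodesics from
  \<open>y\<close> to both \<open>x\<close> and \<open>x'\<close>, and \<open>u'\<close> likewise
  for \<open>y'\<close>. Replacing \<open>y\<close>, \<open>y'\<close> by \<open>u\<close>,
  \<open>u'\<close> subtracts the same amounts from both sums, and thinness seen from
  \<open>x\<close> makes \<open>u\<close> and \<open>u'\<close> near.\<close>

lemma far_defect:
  assumes V: "x \<in> V" "x' \<in> V" "y \<in> V" "y' \<in> V" and c: "d x x' \<le> c" "d y y' \<le> c" and far: "4 * c + 20 \<le> d x y"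
  shows "d x y + d x' y' \<le> d x y' + d x' y + 1"
proof -
  \<comment> \<open>\<open>thin_common\<close> asks for \<open>T \<ge> c + 3\<close>, while
    \<open>near_defect\<close> at distance about \<open>T\<close> from \<open>x\<close> and
    \<open>x'\<close> asks for \<open>T \<ge> c + 4\<close>.\<close>
  define T where "T = c + 4"
  have t: "d x y \<le> d x y' + c" "d x y' \<le> d x y + c" "d x y \<le> d x' y + c" "d x y' \<le> d x' y' + c"
    using d_triangle[of x y' y] d_triangle[of x y y'] d_triangle[of x x' y] d_triangle[of x x' y'] d_sym[of y y'] V c by auto
  define m where "m = d x y - T"
  define m' where "m' = d x y' - T"
  note s = d_sym[OF V(3,1)] d_sym[OF V(3,2)] d_sym[OF V(4,1)] d_sym[OF V(4,2)]
  have "2 * m + 6 + d x x' \<le> d y x + d y x'" using t far c s by (simp add: m_def T_def)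
  then obtain u where u: "on_geodesic y m x u" "on_geodesic y m x' u" using thin_common V by blast
  have "2 * m' + 6 + d x x' \<le> d y' x + d y' x'" using t far c s by (simp add: m'_def T_def)
  then obtain u' where u': "on_geodesic y' m' x u'" "on_geodesic y' m' x' u'" using thin_common V by blast
  have uV: "u \<in> V" "u' \<in> V" using u u' by (auto simp: on_geodesic_def)
  note s' = d_sym[OF uV(1) V(1)] d_sym[OF uV(1) V(2)] d_sym[OF uV(1) V(3)] d_sym[OF uV(2) V(1)] d_sym[OF uV(2) V(2)] d_sym[OF uV(2) V(4)]
  have e: "d u x = T" "m + d u x' = d x' y" "d u' x = T" "m' + d u' x' = d x' y'" "d u y = m" "d u' y' = m'"
    using u u' t far s s' by (auto simp: on_geodesic_def m_def m'_def T_def)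
  have "on_geodesic x T y u" "on_geodesic x T y' u'" using e uV s s' t far by (auto simp: on_geodesic_def m_def m'_def T_def)
  moreover have "2 * T + 4 + d y y' \<le> d x y + d x y'" using t far c by (simp add: T_def)
  ultimately have "near u u'" using thin[OF V(1,3,4)] by blast
  moreover have "8 + d x x' \<le> d u x + d u x'" using e t far c by (simp add: T_def m_def)
  ultimately have "d u x + d u' x' \<le> d u' x + d u x' + 1" using near_defect[OF uV V(1,2)] by blast
  then show ?thesis using e t far by (simp add: m_def m'_def T_def)
qed

text \<open>With \<open>l\<close> the distance between the two sets, all pairs realizing it
  contribute; no choice is made, so the set inherits every symmetry of \<open>P\<close> and
  \<open>Q\<close>.\<close>

definition mid_slice :: "'v set \<Rightarrow> 'v set \<Rightarrow> nat \<Rightarrow> nat \<Rightarrow> 'v set" where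
  "mid_slice P Q l N = {s. \<exists>a\<in>P. \<exists>b\<in>Q. d a b = l \<and> on_geodesic a N b s}"

text \<open>By the defect estimate, any two points of the slice lie on a common shortest connection.\<close>

lemma mid_slice_clique:
  assumes PQ: "P \<subseteq> V" "Q \<subseteq> V" "\<And>a a'. a \<in> P \<Longrightarrow> a' \<in> P \<Longrightarrow> d a a' \<le> c" "\<And>b b'. b \<in> Q \<Longrightarrow> b' \<in> Q \<Longrightarrow> d b b' \<le> c"
    and l: "\<And>a b. a \<in> P \<Longrightarrow> b \<in> Q \<Longrightarrow> l \<le> d a b" and N: "4 * c + 28 \<le> N" "N + 4 * c + 28 \<le> l"
    and s: "s \<in> mid_slice P Q l N" "s' \<in> mid_slice P Q l N"
  shows "near s s'"
proof -
  obtain a b where ab: "a \<in> P" "b \<in> Q" "d a b = l" "on_geodesic a N b s" using s by (auto simp: mid_slice_def)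
  obtain a' b' where ab': "a' \<in> P" "b' \<in> Q" "d a' b' = l" "on_geodesic a' N b' s'" using s by (auto simp: mid_slice_def)
  have V: "a \<in> V" "b \<in> V" "a' \<in> V" "b' \<in> V" "s \<in> V" "s' \<in> V" using ab ab' PQ by (auto simp: on_geodesic_def)
  have cc: "d a a' \<le> c" "d b b' \<le> c" using PQ ab ab' by auto
  have e: "d a s = N" "N + d s b = l" "d a' s' = N" "N + d s' b' = l" using ab ab' by (auto simp: on_geodesic_def)
  have l': "l \<le> d a b'" "l \<le> d a' b" using l ab ab' by auto
  define th where "th = d a b' - l"
  have th: "d a b' = l + th" "th \<le> c" using l' d_triangle[OF V(1,2,4)] ab cc by (auto simp: th_def)
  \<comment> \<open>A rough bound, along a geodesic from \<open>a\<close> to \<open>b'\<close>: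
    \<open>s\<close> is near its point \<open>w\<close> at height \<open>N\<close>, and
    \<open>s'\<close> is near its point \<open>w'\<close> at distance \<open>l - N\<close> from
    \<open>b'\<close>. The two points differ in height by the excess \<open>th\<close>.\<close>
  have ss: "d s s' \<le> c + 2"
  proof -
    obtain w' where w': "on_geodesic a (N + th) b' w'" using on_geodesic_ex[OF V(1,4), of "N + th"] th N by auto
    have w'V: "w' \<in> V" using w' by (simp add: on_geodesic_def)
    obtain w where w: "on_geodesic a N w' w" using on_geodesic_ex[OF V(1) w'V, of N] w' by (auto simp: on_geodesic_def)
    have wb: "on_geodesic a N b' w" using on_geodesic_trans[OF V(1,4) w' w] .
    have 1: "near s w" using thin[OF V(1,2,4) _ ab(4) wb] ab th cc N by simp
    have "on_geodesic b' (l - N) a w'"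
      using w' th N V d_sym[of w' b'] d_sym[of w' a] d_sym[of a b'] by (auto simp: on_geodesic_def)
    moreover have "on_geodesic b' (l - N) a' s'"
      using e N V ab' d_sym[of s' b'] d_sym[of s' a'] d_sym[of a' b'] by (auto simp: on_geodesic_def)
    moreover have "2 * (l - N) + 4 + d a a' \<le> d b' a + d b' a'"
      using N cc th ab' d_sym[OF V(4,1)] d_sym[OF V(4,3)] by simp
    ultimately have 2: "near w' s'" using thin[OF V(4,1,3)] by blast
    have wV: "w \<in> V" using w by (simp add: on_geodesic_def)
    have "d w w' = th" using w w' by (simp add: on_geodesic_def)
    then show ?thesis
      using 1 2 near_d d_triangle[OF V(5) wV V(6)] d_triangle[OF wV w'V V(6)] th V wV w'V by fastforce
  qed
  have sy: "d s' s = d s s'" "d b s = d s b" "d b s' = d s' b" "d b' s = d s b'" "d b' s' = d s' b'" using d_sym V by auto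
  have t: "l \<le> d a s' + d s' b'" "l \<le> d a' s + d s b" "l \<le> d a s + d s b'" "l \<le> d a' s' + d s' b"
    using d_triangle[OF V(1,6,4)] d_triangle[OF V(3,5,2)] d_triangle[OF V(1,5,4)] d_triangle[OF V(3,6,2)] l' by auto
  \<comment> \<open>The rough bound lets \<open>far_defect\<close> apply with \<open>c + 2\<close>,
    whence the 28 in the bounds on \<open>N\<close>. Both distances are at least \<open>N\<close>
    and their sum is at most \<open>2 * N + 1\<close>, so one of them is \<open>N\<close>. The same
    argument at the other end supplies a pair with both points in its slice.\<close>
  have "d a s' + d a' s \<le> d a s + d a' s' + 1"
    by (rule far_defect[OF V(1,3,6,5), of "c + 2"]) (use cc ss sy e t N in auto)
  then have x: "d a s' = N \<or> d a' s = N" using e t by linarith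
  have "d b s' + d b' s \<le> d b s + d b' s' + 1"
    by (rule far_defect[OF V(2,4,6,5), of "c + 2"]) (use cc ss sy e t N in auto)
  then have y: "N + d s' b = l \<or> N + d s b' = l" using e t sy N by linarith
  have key: "near s s'"
    if "p \<in> V" "q \<in> V" "l \<le> d p q" "d p s = N" "d p s' = N" "N + d s q = l" "N + d s' q = l" for p q
  proof -
    have "d p q = l" using d_triangle[OF that(1) V(5) that(2)] that by simp
    then have e: "on_geodesic p N q s" "on_geodesic p N q s'" using that V by (auto simp: on_geodesic_def)
    have "N < d p q" using that(3) N by simp
    then show ?thesis using on_geodesic_clique[OF that(1,2) _ e] by blast
  qed
  show ?thesis
    using x y
  proof (elim disjE)
    assume "d a s' = N" "N + d s' b = l"
    then show ?thesis using key[of a b] V e ab by simp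
  next
    assume "d a s' = N" "N + d s b' = l"
    then show ?thesis using key[of a b'] V e l' by simp
  next
    assume "d a' s = N" "N + d s' b = l"
    then show ?thesis using key[of a' b] V e l' by simp
  next
    assume "d a' s = N" "N + d s b' = l"
    then show ?thesis using key[of a' b'] V e ab' by simp
  qed
qed

lemma mid_slice_edge:
  assumes "P \<subseteq> V" "Q \<subseteq> V" "a \<in> P" "b \<in> Q" "d a b = l" "N < l"
  shows "\<exists>s\<in>mid_slice P Q l N. \<exists>s'\<in>mid_slice P Q l (Suc N). adj s s'"
proof -
  have V: "a \<in> V" "b \<in> V" using assms by auto
  obtain s where s: "on_geodesic a N b s" using on_geodesic_ex[OF V, of N] assms by auto
  obtain s' where "on_geodesic a (Suc N) b s'" "adj s' s" using on_geodesic_up[OF V s] assms by auto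
  then show ?thesis using s assms adj_sym unfolding mid_slice_def by blast
qed

text \<open>Since \<open>d y y'\<close> stays far below the sum of the two lengths beyond
  \<open>z\<close> and \<open>z'\<close>, the first use of \<open>four_point\<close> puts
  \<open>z\<close> on a shortest connection from \<open>x\<close> to \<open>y'\<close> up to an
  error 7. The second compares it with \<open>z'\<close> there and costs another 7.\<close>

lemma displacement_close:
  assumes V: "x \<in> V" "y \<in> V" "z \<in> V" "x' \<in> V" "y' \<in> V" "z' \<in> V" and c: "d x x' \<le> c"
    and z: "d x y = R" "d x z = M" "M + d z y = R" and z': "d x' y' = R" "d x' z' = M" "M + d z' y' = R"
    and R: "2 * M + 4 * c + 20 \<le> R" "d y y' < R + 3 * c + 8"
  shows "d z z' \<le> c + 14"
proof -
  have t: "R \<le> d x y' + c" "d x y' \<le> R + c" "d x z' \<le> M + c"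
    using d_triangle[of x' x y'] d_triangle[of x x' y'] d_triangle[of x x' z'] d_sym[of x x'] V c z' by auto
  have s: "d y' z' = d z' y'" using d_sym V by auto
  have "d z y' + d x y \<le> max (d z y + d x y') (d y y' + d x z) + 7" using four_point[OF V(1,3,2,5)] .
  then have 1: "d z y' + M \<le> d x y' + 7" using z R t by (auto simp: max_def split: if_splits)
  have "d z z' + d x y' \<le> max (d z y' + d x z') (d y' z' + d x z) + 7" using four_point[OF V(1,3,5,6)] .
  then show ?thesis using 1 t s z z' by (auto simp: max_def split: if_splits)
qed

text \<open>The distance to \<open>A 0\<close> increases strictly. In \<open>four_point\<close> the
  alternative without \<open>A (Suc (Suc i))\<close> would force a decrease at the previous step,
  because the margin 8 exceeds the error 7.\<close>

lemma local_quasigeodesic: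
  assumes V: "\<And>i. A i \<in> V" and 1: "1 \<le> d (A 0) (A 1)" and s: "\<And>i. d (A i) (A (Suc i)) \<le> L"
    and t: "\<And>i. L + 8 \<le> d (A i) (A (Suc (Suc i)))"
  shows "i \<le> d (A 0) (A i)"
proof -
  have step: "Suc (d (A 0) (A i)) \<le> d (A 0) (A (Suc i))" for i
  proof (induction i)
    case 0 then show ?case using 1 V d_self by simp
  next
    case (Suc i)
    have "d (A i) (A (Suc (Suc i))) + d (A 0) (A (Suc i))
       \<le> max (d (A i) (A (Suc i)) + d (A 0) (A (Suc (Suc i)))) (d (A (Suc i)) (A (Suc (Suc i))) + d (A 0) (A i)) + 7"
      using four_point V by blast
    then show ?case using s[of i] s[of "Suc i"] t[of i] Suc by linarith
  qed
  show ?thesis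
  proof (induction i)
    case (Suc i) then show ?case using step[of i] by linarith
  qed simp
qed

end

section \<open>Displacement estimates for a rigid action\<close>

locale rigid_action = bridged_graph adj V d + group G
  for adj :: "'v \<Rightarrow> 'v \<Rightarrow> bool" and V d and G (structure) +
  fixes \<phi> :: "'g \<Rightarrow> 'v \<Rightarrow> 'v"
  assumes act_V: "\<lbrakk>g \<in> carrier G; x \<in> V\<rbrakk> \<Longrightarrow> \<phi> g x \<in> V"
    and act_mult: "\<lbrakk>g \<in> carrier G; h \<in> carrier G; x \<in> V\<rbrakk> \<Longrightarrow> \<phi> (g \<otimes> h) x = \<phi> g (\<phi> h x)"
    and act_one: "x \<in> V \<Longrightarrow> \<phi> \<one> x = x"
    and act_d: "\<lbrakk>g \<in> carrier G; x \<in> V; y \<in> V\<rbrakk> \<Longrightarrow> d (\<phi> g x) (\<phi> g y) = d x y"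
    and rigid: "\<lbrakk>g \<in> carrier G; K \<subseteq> V; \<And>u v. u \<in> K \<Longrightarrow> v \<in> K \<Longrightarrow> near u v; u \<in> K; v \<in> K; u \<noteq> v; \<phi> g ` K = K\<rbrakk> \<Longrightarrow> g = \<one>"
    and locally_bounded: "\<lbrakk>g \<in> carrier G; x \<in> V\<rbrakk> \<Longrightarrow> \<exists>c. \<forall>h\<in>generate G {g}. d x (\<phi> h x) \<le> c"
begin

lemma act_inv: "\<lbrakk>g \<in> carrier G; x \<in> V\<rbrakk> \<Longrightarrow> \<phi> (inv g) (\<phi> g x) = x" "\<lbrakk>g \<in> carrier G; x \<in> V\<rbrakk> \<Longrightarrow> \<phi> g (\<phi> (inv g) x) = x"
  using act_mult[of "inv g" g x] act_mult[of g "inv g" x] act_one by auto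

lemma act_shift: assumes "g \<in> carrier G" "x \<in> V" "y \<in> V" shows "d (\<phi> g x) y = d x (\<phi> (inv g) y)"
proof -
  have "d (\<phi> g x) (\<phi> g (\<phi> (inv g) y)) = d x (\<phi> (inv g) y)" using act_d act_V assms by simp
  then show ?thesis using act_inv(2) assms by simp
qed

lemma orbit_diam:
  assumes H: "subgroup H G" "\<And>h. h \<in> H \<Longrightarrow> d x (\<phi> h x) \<le> c" "x \<in> V" and h: "h \<in> H" "h' \<in> H"
  shows "d (\<phi> h x) (\<phi> h' x) \<le> c"
proof -
  have G: "h \<in> carrier G" "h' \<in> carrier G" "inv h \<otimes> h' \<in> H"
    using H h subgroup.subset subgroup.m_inv_closed subgroup.m_closed by (blast, blast, metis)
  have "d (\<phi> h x) (\<phi> h' x) = d x (\<phi> (inv h \<otimes> h') x)" using act_shift act_mult act_V G H by simp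
  then show ?thesis using H G by simp
qed

lemma mid_slice_invariant:
  assumes H: "subgroup H G" "x \<in> V" "y \<in> V" "h \<in> H"
  shows "\<phi> h ` mid_slice ((\<lambda>k. \<phi> k x) ` H) ((\<lambda>k. \<phi> k y) ` H) l N = mid_slice ((\<lambda>k. \<phi> k x) ` H) ((\<lambda>k. \<phi> k y) ` H) l N"
proof -
  have sub: "\<phi> h ` mid_slice ((\<lambda>k. \<phi> k x) ` H) ((\<lambda>k. \<phi> k y) ` H) l N \<subseteq> mid_slice ((\<lambda>k. \<phi> k x) ` H) ((\<lambda>k. \<phi> k y) ` H) l N"
    if h: "h \<in> H" for h
  proof
    fix t assume "t \<in> \<phi> h ` mid_slice ((\<lambda>k. \<phi> k x) ` H) ((\<lambda>k. \<phi> k y) ` H) l N"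
    then obtain s k k' where s: "t = \<phi> h s" "k \<in> H" "k' \<in> H" "d (\<phi> k x) (\<phi> k' y) = l" "on_geodesic (\<phi> k x) N (\<phi> k' y) s"
      by (auto simp: mid_slice_def)
    have G: "h \<in> carrier G" "k \<in> carrier G" "k' \<in> carrier G" using subgroup.subset[OF H(1)] s h by auto
    have V: "\<phi> k x \<in> V" "\<phi> k' y \<in> V" "s \<in> V" using act_V G H s by (auto simp: on_geodesic_def)
    have e: "\<phi> (h \<otimes> k) x = \<phi> h (\<phi> k x)" "\<phi> (h \<otimes> k') y = \<phi> h (\<phi> k' y)" using act_mult G H by auto
    have "on_geodesic (\<phi> (h \<otimes> k) x) N (\<phi> (h \<otimes> k') y) t" "d (\<phi> (h \<otimes> k) x) (\<phi> (h \<otimes> k') y) = l"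
      using s(1,4,5) V G act_d act_V unfolding e on_geodesic_def by auto
    moreover have "h \<otimes> k \<in> H" "h \<otimes> k' \<in> H" using subgroup.m_closed[OF H(1)] h s by auto
    ultimately show "t \<in> mid_slice ((\<lambda>k. \<phi> k x) ` H) ((\<lambda>k. \<phi> k y) ` H) l N" by (auto simp: mid_slice_def)
  qed
  moreover have "mid_slice ((\<lambda>k. \<phi> k x) ` H) ((\<lambda>k. \<phi> k y) ` H) l N \<subseteq> \<phi> h ` mid_slice ((\<lambda>k. \<phi> k x) ` H) ((\<lambda>k. \<phi> k y) ` H) l N"
  proof
    fix t assume t: "t \<in> mid_slice ((\<lambda>k. \<phi> k x) ` H) ((\<lambda>k. \<phi> k y) ` H) l N"
    have i: "inv h \<in> H" using subgroup.m_inv_closed[OF H(1,4)] .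
    have "t \<in> V" using t by (auto simp: mid_slice_def on_geodesic_def)
    moreover have "h \<in> carrier G" using subgroup.subset[OF H(1)] H(4) by auto
    ultimately have "t = \<phi> h (\<phi> (inv h) t)" using act_inv by simp
    moreover have "\<phi> (inv h) t \<in> mid_slice ((\<lambda>k. \<phi> k x) ` H) ((\<lambda>k. \<phi> k y) ` H) l N" using sub[OF i] t by blast
    ultimately show "t \<in> \<phi> h ` mid_slice ((\<lambda>k. \<phi> k x) ` H) ((\<lambda>k. \<phi> k y) ` H) l N" by blast
  qed
  ultimately show ?thesis using H by blast
qed

text \<open>Rigidity is used twice: an invariant clique has only one vertex, and the single vertices
  of two consecutive slices would span an edge fixed by \<open>h0\<close>.\<close>

lemma small_orbits_close:
  assumes H: "subgroup H G" "h0 \<in> H" "h0 \<noteq> \<one>" and V: "x \<in> V" "y \<in> V"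
    and c: "\<And>h. h \<in> H \<Longrightarrow> d x (\<phi> h x) \<le> c" "\<And>h. h \<in> H \<Longrightarrow> d y (\<phi> h y) \<le> c"
  shows "d x y < 10 * c + 60"
proof (rule ccontr)
  assume far: "\<not> ?thesis"
  define P where "P = (\<lambda>k. \<phi> k x) ` H"
  define Q where "Q = (\<lambda>k. \<phi> k y) ` H"
  have HG: "H \<subseteq> carrier G" using subgroup.subset[OF H(1)] .
  have PQ: "P \<subseteq> V" "Q \<subseteq> V" using act_V V HG by (auto simp: P_def Q_def)
  have diam: "d a a' \<le> c" if "a \<in> P" "a' \<in> P" for a a'
    using that orbit_diam[OF H(1) c(1) V(1)] by (auto simp: P_def)
  have diam': "d a a' \<le> c" if "a \<in> Q" "a' \<in> Q" for a a'
    using that orbit_diam[OF H(1) c(2) V(2)] by (auto simp: Q_def)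
  have one: "\<one> \<in> H" using subgroup.one_closed[OF H(1)] .
  then have xy: "x \<in> P" "y \<in> Q" using act_one V unfolding P_def Q_def by (metis imageI)+
  define l where "l = (LEAST l. \<exists>a\<in>P. \<exists>b\<in>Q. d a b = l)"
  have "\<exists>a\<in>P. \<exists>b\<in>Q. d a b = l" unfolding l_def by (rule LeastI_ex) (use xy in blast)
  then obtain a b where ab: "a \<in> P" "b \<in> Q" "d a b = l" by blast
  have l: "l \<le> d a b" if "a \<in> P" "b \<in> Q" for a b unfolding l_def by (rule Least_le) (use that in blast)
  have aV: "a \<in> V" "b \<in> V" using ab PQ by auto
  have "d x y \<le> d x a + d a b + d b y" using d_triangle[of x a y] d_triangle[of a b y] V aV by simp
  then have big: "8 * c + 60 \<le> l" using diam[OF xy(1) ab(1)] diam'[OF ab(2) xy(2)] ab(3) far by simp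
  \<comment> \<open>The least height allowed by \<open>mid_slice_clique\<close>. For the next slice
    \<open>Suc N\<close> the other end needs \<open>8 * c + 57 \<le> l\<close>.\<close>
  define N where "N = 4 * c + 28"
  have cl: "near s s'" if "s \<in> mid_slice P Q l M" "s' \<in> mid_slice P Q l M" "M = N \<or> M = Suc N" for s s' M
    by (rule mid_slice_clique[OF PQ diam diam' l _ _ that(1,2)]) (use that(3) big in \<open>auto simp: N_def\<close>)
  have inv: "\<phi> h0 ` mid_slice P Q l M = mid_slice P Q l M" for M
    unfolding P_def Q_def by (rule mid_slice_invariant[OF H(1) V H(2)])
  have sV: "mid_slice P Q l M \<subseteq> V" for M by (auto simp: mid_slice_def on_geodesic_def)
  have single: "s = s'" if "s \<in> mid_slice P Q l M" "s' \<in> mid_slice P Q l M" "M = N \<or> M = Suc N" for s s' M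
  proof (rule ccontr)
    assume "s \<noteq> s'"
    then have "h0 = \<one>" using rigid[of h0 "mid_slice P Q l M" s s'] inv sV cl that HG H by blast
    then show False using H by simp
  qed
  obtain s s' where s: "s \<in> mid_slice P Q l N" "s' \<in> mid_slice P Q l (Suc N)" "adj s s'"
    using mid_slice_edge[OF PQ ab, of N] big unfolding N_def by fastforce
  have "mid_slice P Q l N = {s}" "mid_slice P Q l (Suc N) = {s'}" using single s by blast+
  then have "\<phi> h0 s = s" "\<phi> h0 s' = s'" using inv[of N] inv[of "Suc N"] by auto
  moreover have ss: "s \<noteq> s'" "s \<in> V" "s' \<in> V" using s(3) adj_irrefl adj_V adj_V2 by blast+
  moreover have "near u v" if "u \<in> {s, s'}" "v \<in> {s, s'}" for u v
    using that s(3) adj_sym[OF s(3)] by (auto simp: near_def)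
  moreover have "h0 \<in> carrier G" using HG H(2) by blast
  ultimately have "h0 = \<one>" by (intro rigid[of h0 "{s, s'}" s s']) auto
  then show False using H by simp
qed

lemma large_displacement:
  assumes H: "subgroup H G" "h0 \<in> H" "h0 \<noteq> \<one>" and V: "x \<in> V" "y \<in> V"
    and c: "\<And>h. h \<in> H \<Longrightarrow> d x (\<phi> h x) \<le> c" and R: "24 * c + 420 \<le> d x y"
  shows "\<exists>h\<in>H. d x y + 3 * c + 8 \<le> d y (\<phi> h y)"
proof (rule ccontr)
  assume n: "\<not> ?thesis"
  \<comment> \<open>If \<open>y\<close> were moved little, \<open>z\<close> would be moved by at
    most \<open>c + 14\<close>; then \<open>small_orbits_close\<close> gives
    \<open>d x z < 10 * (c + 14) + 60\<close>, which is \<open>M\<close>. The bound on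
    \<open>d x y\<close> is \<open>2 * M + 4 * c + 20\<close>, as demanded by
    \<open>displacement_close\<close>.\<close>
  define M where "M = 10 * c + 200"
  obtain z where z: "on_geodesic x M y z" using on_geodesic_ex[OF V, of M] R M_def by auto
  have zV: "z \<in> V" using z by (simp add: on_geodesic_def)
  have "d z (\<phi> h z) \<le> c + 14" if h: "h \<in> H" for h
  proof -
    have G: "h \<in> carrier G" using h subgroup.subset[OF H(1)] by auto
    show ?thesis
      by (rule displacement_close[where x = x and y = y and x' = "\<phi> h x" and y' = "\<phi> h y" and R = "d x y" and M = M])
        (use z zV V c[OF h] h n R G act_V act_d in \<open>auto simp: on_geodesic_def M_def not_le\<close>)
  qed
  then have "d x z < 10 * (c + 14) + 60"
    using small_orbits_close[OF H V(1) zV, of "c + 14"] c by (meson le_add1 le_trans)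
  then show False using z by (simp add: on_geodesic_def M_def)
qed

lemma orbit_bounded:
  assumes g: "g \<in> carrier G" "g \<noteq> \<one>" and x: "x \<in> V" and c: "\<And>h. h \<in> generate G {g} \<Longrightarrow> d x (\<phi> h x) \<le> c"
    and h: "h \<in> carrier G"
  shows "d x (\<phi> h x) < 24 * c + 420"
proof (rule ccontr)
  assume "\<not> ?thesis"
  then have R: "24 * c + 420 \<le> d x (\<phi> h x)" by simp
  define H where "H = generate G {g}"
  have H: "subgroup H G" unfolding H_def using generate_is_subgroup g by simp
  have HG: "H \<subseteq> carrier G" using subgroup.subset[OF H] .
  have gH: "g \<in> H" unfolding H_def by (rule generate.incl) simp
  define y where "y = \<phi> h x"
  define y' where "y' = \<phi> (inv h) x"
  have V: "y \<in> V" "y' \<in> V" using act_V h x by (auto simp: y_def y'_def)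
  have "d x y' = d x y" using act_shift[OF h x x] d_sym[OF x V(1)] by (simp add: y_def y'_def)
  then have R': "24 * c + 420 \<le> d x y" "24 * c + 420 \<le> d x y'" using R by (auto simp: y_def)
  have cH: "\<And>h. h \<in> H \<Longrightarrow> d x (\<phi> h x) \<le> c" using c by (simp add: H_def)
  obtain p where p: "p \<in> H" "d x y + 3 * c + 8 \<le> d y (\<phi> p y)"
    using large_displacement[OF H gH g(2) x V(1) cH R'(1)] by blast
  obtain k where k: "k \<in> H" "d x y' + 3 * c + 8 \<le> d y' (\<phi> k y')"
    using large_displacement[OF H gH g(2) x V(2) cH R'(2)] by blast
  have G: "p \<in> carrier G" "k \<in> carrier G" using p k HG by auto
  \<comment> \<open>Conjugation by \<open>h\<close> exchanges the roles of the points: as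
    \<open>h\<close> takes \<open>x\<close> to \<open>y\<close> and \<open>y'\<close> to
    \<open>x\<close>, \<open>q\<close> moves \<open>y\<close> little and \<open>x\<close> far,
    opposite to \<open>p\<close>.\<close>
  define q where "q = h \<otimes> k \<otimes> inv h"
  have qG: "q \<in> carrier G" using G h by (simp add: q_def)
  have q: "\<phi> q z = \<phi> h (\<phi> k (\<phi> (inv h) z))" if "z \<in> V" for z
    using that G h act_mult act_V by (simp add: q_def)
  have qx: "d x y + 3 * c + 8 \<le> d x (\<phi> q x)"
  proof -
    have "d y' (\<phi> k y') = d (\<phi> h y') (\<phi> h (\<phi> k y'))" using act_d act_V G h V by simp
    also have "\<phi> h y' = x" using act_inv h x by (simp add: y'_def)
    also have "\<phi> h (\<phi> k y') = \<phi> q x" using q x by (simp add: y'_def)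
    finally show ?thesis using k \<open>d x y' = d x y\<close> by simp
  qed
  have qy: "d y (\<phi> q y) \<le> c"
  proof -
    have "\<phi> q y = \<phi> h (\<phi> k x)" using q[OF V(1)] act_inv h x by (simp add: y_def)
    then have "d y (\<phi> q y) = d x (\<phi> k x)" using act_d act_V h G x by (simp add: y_def)
    then show ?thesis using cH k by simp
  qed
  define f where "f = q \<otimes> p"
  have fG: "f \<in> carrier G" using qG G by (simp add: f_def)
  have f: "\<phi> f z = \<phi> q (\<phi> p z)" if "z \<in> V" for z using that act_mult qG G by (simp add: f_def)
  have W: "\<phi> p x \<in> V" "\<phi> p y \<in> V" "\<phi> q x \<in> V" "\<phi> q y \<in> V" "\<phi> f x \<in> V" "\<phi> f y \<in> V" using act_V qG G fG x V by auto
  have px: "d x (\<phi> p x) \<le> c" using cH p by simp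
  have yfx: "d y (\<phi> f x) \<le> d x y + 2 * c"
  proof -
    have "d (\<phi> q y) (\<phi> f x) = d y (\<phi> p x)" using f[OF x] act_d[OF qG V(1) W(1)] by simp
    then show ?thesis
      using d_triangle[OF V(1) W(4,5)] d_triangle[OF V(1) x W(1)] d_sym[OF x V(1)] px qy by simp
  qed
  have xfx: "d x y + 2 * c + 8 \<le> d x (\<phi> f x)"
  proof -
    have "d (\<phi> f x) (\<phi> q x) = d (\<phi> p x) x" using f[OF x] act_d[OF qG W(1) x] by simp
    then show ?thesis using d_triangle[OF x W(5,3)] d_sym[OF x W(1)] px qx by simp
  qed
  have yfy: "d x y + 2 * c + 8 \<le> d y (\<phi> f y)"
  proof -
    have "d (\<phi> q y) (\<phi> f y) = d y (\<phi> p y)" using f[OF V(1)] act_d[OF qG V(1) W(2)] by simp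
    then show ?thesis using d_triangle[OF W(4) V(1) W(6)] d_sym[OF V(1) W(4)] p qy by simp
  qed
  \<comment> \<open>The sequence \<open>x\<close>, \<open>y\<close>, \<open>f x\<close>,
    \<open>f y\<close>, and so on: steps are at most \<open>d x y + 2 * c\<close> and double steps
    at least 8 longer, so it runs off to infinity along powers of \<open>f\<close>, against local
    boundedness.\<close>
  define A where "A i = \<phi> (f [^] (i div 2)) (if even i then x else y)" for i :: nat
  have fn: "f [^] n \<in> carrier G" for n :: nat using fG by simp
  have AV: "A i \<in> V" for i using act_V fn x V by (simp add: A_def)
  have next_f: "\<phi> (f [^] Suc n) z = \<phi> (f [^] n) (\<phi> f z)" if "z \<in> V" for n :: nat and z
    using act_mult[OF fn fG that] by simp
  have A1: "d (A i) (A (Suc i)) \<le> d x y + 2 * c" for i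
  proof (cases "even i")
    case True
    then show ?thesis using act_d[OF fn x V(1)] by (simp add: A_def)
  next
    case False
    then have "Suc i div 2 = Suc (i div 2)" by (metis even_Suc_div_two odd_Suc_div_two)
    then show ?thesis using False act_d[OF fn V(1) W(5)] yfx next_f[OF x] by (simp add: A_def)
  qed
  have A2: "d x y + 2 * c + 8 \<le> d (A i) (A (Suc (Suc i)))" for i
    using act_d[OF fn V(1) W(6)] act_d[OF fn x W(5)] xfx yfy next_f[OF x] next_f[OF V(1)] by (simp add: A_def)
  have "1 \<le> d (A 0) (A 1)" using R' act_one x V by (simp add: A_def)
  then have grow: "i \<le> d (A 0) (A i)" for i using local_quasigeodesic[of A, OF AV _ A1 A2] by blast
  obtain b where b: "\<forall>h\<in>generate G {f}. d x (\<phi> h x) \<le> b" using locally_bounded[OF fG x] by blast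
  have "f [^] n \<in> generate G {f}" for n :: nat
  proof (induction n)
    case 0 then show ?case by (simp add: generate.one)
  next
    case (Suc n) then show ?case by (simp add: generate.eng generate.incl)
  qed
  then have "d x (\<phi> (f [^] Suc b) x) \<le> b" using b by blast
  moreover have "A 0 = x" "A (2 * Suc b) = \<phi> (f [^] Suc b) x" using act_one x by (simp_all add: A_def del: nat_pow_Suc)
  ultimately have "d (A 0) (A (2 * Suc b)) \<le> b" by simp
  then show False using grow[of "2 * Suc b"] by simp
qed

theorem action_bounded:
  assumes x: "x \<in> V"
  shows "\<exists>c. \<forall>g\<in>carrier G. \<forall>h\<in>carrier G. d (\<phi> g x) (\<phi> h x) \<le> c"
proof -
  have "\<exists>c. \<forall>h\<in>carrier G. d x (\<phi> h x) \<le> c"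
  proof (cases "\<exists>g\<in>carrier G. g \<noteq> \<one>")
    case True
    then obtain g where g: "g \<in> carrier G" "g \<noteq> \<one>" by blast
    then obtain c where c: "\<forall>h\<in>generate G {g}. d x (\<phi> h x) \<le> c" using locally_bounded x by blast
    have "d x (\<phi> h x) \<le> 24 * c + 420" if "h \<in> carrier G" for h
      using orbit_bounded[OF g x _ that, of c] c by simp
    then show ?thesis by blast
  next
    case False
    then have "d x (\<phi> h x) \<le> 0" if "h \<in> carrier G" for h using that act_one[OF x] d_self[OF x] by (cases "h = \<one>") auto
    then show ?thesis by blast
  qed
  then obtain c where "\<forall>h\<in>carrier G. d x (\<phi> h x) \<le> c" by blast
  then have "d (\<phi> g x) (\<phi> h x) \<le> c" if "g \<in> carrier G" "h \<in> carrier G" for g h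
    using orbit_diam[OF subgroup_self _ x that, of c] by blast
  then show ?thesis by blast
qed

end

section \<open>Homotopies in the realization\<close>

lemma topspace_realization: "topspace (realization X) = realization_points X"
proof -
  have "openin (realization X) (realization_points X)"
    unfolding openin_realization by (auto simp: closed_cell_def Int_absorb1)
  then show ?thesis using openin_realization openin_topspace openin_subset by (metis subset_antisym)
qed

definition open_star :: "'v set set \<Rightarrow> 'v \<Rightarrow> ('v \<Rightarrow> real) set" where
  "open_star X w = {x \<in> realization_points X. 0 < x w}"

lemma openin_open_star: "openin (realization X) (open_star X w)"
proof -
  have "open {x :: 'a \<Rightarrow> real. 0 < x w}"
    by (intro open_Collect_less continuous_on_const continuous_on_product_coordinates)
  then have "openin (top_of_set (closed_cell X \<sigma>)) (closed_cell X \<sigma> \<inter> {x. 0 < x w})" for \<sigma>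
    by (rule openin_open_Int)
  moreover have "open_star X w \<inter> closed_cell X \<sigma> = closed_cell X \<sigma> \<inter> {x. 0 < x w}" for \<sigma>
    by (auto simp: open_star_def closed_cell_def)
  ultimately show ?thesis by (auto simp: openin_realization open_star_def)
qed

definition vertex_point :: "'v \<Rightarrow> 'v \<Rightarrow> real" where
  "vertex_point u = (\<lambda>x. if x = u then 1 else 0)"

definition segment_point :: "'v \<Rightarrow> 'v \<Rightarrow> real \<Rightarrow> 'v \<Rightarrow> real" where
  "segment_point u v l = (\<lambda>x. (1 - l) * vertex_point u x + l * vertex_point v x)"

lemma segment_point_ends [simp]: "segment_point u v 0 = vertex_point u" "segment_point u v 1 = vertex_point v"
  by (auto simp: segment_point_def)

lemma segment_point_support: "segment_point u v l x \<noteq> 0 \<Longrightarrow> x = u \<or> x = v"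
  by (auto simp: segment_point_def vertex_point_def split: if_splits)

section \<open>Edge paths and components of the realization\<close>

locale simplicial_complex = fixes X :: "'v set set"
  assumes complex: "abstract_complex X"
begin

sublocale simple_graph "adjacent X"
  by unfold_locales (auto simp: adjacent_def insert_commute)

lemma adjacent_vertices: "adjacent X u v \<Longrightarrow> u \<in> vertices X"
  by (auto simp: adjacent_def vertices_def)

lemma face: "\<sigma> \<in> X \<Longrightarrow> \<tau> \<subseteq> \<sigma> \<Longrightarrow> \<tau> \<noteq> {} \<Longrightarrow> \<tau> \<in> X"
  using complex unfolding abstract_complex_def by blast

lemma simplex_nonempty: "\<sigma> \<in> X \<Longrightarrow> \<sigma> \<noteq> {}"
  using complex unfolding abstract_complex_def by blast

lemma star_near: assumes "x \<in> open_star X u" "x \<in> open_star X v" shows "near u v"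
proof -
  have "{v. x v \<noteq> 0} \<in> X" "{u, v} \<subseteq> {v. x v \<noteq> 0}"
    using assms by (auto simp: open_star_def realization_points_def)
  then have "{u, v} \<in> X" using face by blast
  then show ?thesis by (auto simp: near_def adjacent_def)
qed

lemma edge_in: "u \<in> vertices X \<Longrightarrow> near u v \<Longrightarrow> {u, v} \<in> X"
  using face[of _ "{u}"] by (auto simp: near_def adjacent_def vertices_def)

lemma segment_point_cell:
  assumes uv: "u \<in> vertices X" "near u v" and l: "0 \<le> l" "l \<le> 1"
  shows "segment_point u v l \<in> closed_cell X {u, v}"
proof -
  let ?S = "{x. segment_point u v l x \<noteq> 0}"
  have sub: "?S \<subseteq> {u, v}" by (auto dest: segment_point_support)
  have "(\<Sum>x\<in>?S. segment_point u v l x) = (\<Sum>x\<in>{u, v}. segment_point u v l x)"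
    by (rule sum.mono_neutral_left) (use sub in auto)
  also have "\<dots> = 1" by (cases "u = v") (auto simp: segment_point_def vertex_point_def)
  finally have sum: "(\<Sum>x\<in>?S. segment_point u v l x) = 1" .
  then have "?S \<noteq> {}" by force
  then have "?S \<in> X" using face[OF edge_in[OF uv] sub] by blast
  then show ?thesis using sub sum l
    by (auto simp: closed_cell_def realization_points_def segment_point_def vertex_point_def)
qed

text \<open>The segment stays in one closed cell, where the weak topology is the Euclidean
  one.\<close>

lemma segment_point_continuous:
  assumes uv: "u \<in> vertices X" "near u v"
  shows "continuous_map (top_of_set {0..1}) (realization X) (segment_point u v)"
proof -
  let ?s = "segment_point u v" and ?C = "closed_cell X {u, v}"
  have C: "?s \<in> {0..1} \<rightarrow> ?C" using segment_point_cell[OF uv] by auto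
  have cont: "continuous_on {0..1} ?s"
    unfolding segment_point_def by (intro continuous_intros)
  show ?thesis
    unfolding continuous_map_def
  proof (intro conjI allI impI)
    show "?s \<in> topspace (top_of_set {0..1}) \<rightarrow> topspace (realization X)"
      using C by (auto simp: topspace_realization closed_cell_def)
    fix U assume "openin (realization X) U"
    then have "openin (top_of_set ?C) (U \<inter> ?C)" using edge_in[OF uv] by (simp add: openin_realization)
    then have "openin (top_of_set {0..1}) ({0..1} \<inter> ?s -` (U \<inter> ?C))"
      using continuous_openin_preimage[OF cont C] by blast
    moreover have "{0..1} \<inter> ?s -` (U \<inter> ?C) = {x \<in> topspace (top_of_set {0..1}). ?s x \<in> U}" using C by auto
    ultimately show "openin (top_of_set {0..1}) {x \<in> topspace (top_of_set {0..1}). ?s x \<in> U}" by simp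
  qed
qed

lemma edge_path:
  fixes m :: nat
  assumes c: "\<And>i. i \<le> m \<Longrightarrow> c i \<in> vertices X" "\<And>i. i < m \<Longrightarrow> near (c i) (c (Suc i))" and m: "0 < m"
  obtains p where "pathin (realization X) p"
    "\<And>k (t::real). k < m \<Longrightarrow> real k \<le> real m * t \<Longrightarrow> real m * t \<le> real (Suc k) \<Longrightarrow> p t = segment_point (c k) (c (Suc k)) (real m * t - real k)"
proof -
  define T where "T k = {t::real. 0 \<le> t \<and> t \<le> 1 \<and> real k \<le> real m * t \<and> real m * t \<le> real (Suc k)}" for k
  define f where "f k t = segment_point (c k) (c (Suc k)) (real m * t - k)" for k and t :: real
  have Tc: "closed (T k)" for k
    unfolding T_def by (intro closed_Collect_conj closed_Collect_le continuous_intros)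
  have "\<exists>k<m. t \<in> T k" if t: "t \<in> {0..1}" for t
  proof (cases "t = 1")
    \<comment> \<open>At \<open>t = 1\<close> the floor would be \<open>m\<close>, one past the last
      segment.\<close>
    case True
    then show ?thesis using m by (intro exI[of _ "m - 1"]) (auto simp: T_def of_nat_diff)
  next
    case False
    have "0 \<le> real m * t" using t by simp
    then have "real (nat \<lfloor>real m * t\<rfloor>) = of_int \<lfloor>real m * t\<rfloor>" by simp
    then have fl: "real (nat \<lfloor>real m * t\<rfloor>) \<le> real m * t" "real m * t < real (Suc (nat \<lfloor>real m * t\<rfloor>))"
      unfolding of_nat_Suc
      using of_int_floor_le[of "real m * t"] real_of_int_floor_add_one_gt[of "real m * t"] by linarith+
    have "real m * t < real m * 1" using t False m by (intro mult_strict_left_mono) auto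
    then have "real (nat \<lfloor>real m * t\<rfloor>) < real m" using fl(1) by linarith
    then have "nat \<lfloor>real m * t\<rfloor> < m" by (simp only: of_nat_less_iff)
    then show ?thesis using fl t by (intro exI[of _ "nat \<lfloor>real m * t\<rfloor>"]) (auto simp: T_def)
  qed
  then have cov: "topspace (top_of_set {0..1}) \<subseteq> \<Union> (T ` {..<m})" by fastforce
  have clo: "closedin (top_of_set {0..1}) (T k)" for k
    using Tc by (intro closed_subset) (auto simp: T_def)
  have cont: "continuous_map (subtopology (top_of_set {0..1}) (T k)) (realization X) (f k)" if "k \<in> {..<m}" for k
  proof -
    have "continuous_map (top_of_set (T k)) (top_of_set {0..1}) (\<lambda>t. real m * t - k)"
      by (auto simp: T_def continuous_map_in_subtopology intro!: continuous_intros)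
    then have "continuous_map (top_of_set (T k)) (realization X) (segment_point (c k) (c (Suc k)) \<circ> (\<lambda>t. real m * t - k))"
      by (rule continuous_map_compose) (use that c in \<open>auto intro: segment_point_continuous\<close>)
    moreover have "subtopology (top_of_set {0..1}) (T k) = top_of_set (T k)"
      by (simp add: subtopology_subtopology) (rule arg_cong[where f = top_of_set], auto simp: T_def)
    ultimately show ?thesis by (simp add: o_def f_def[abs_def])
  qed
  have agree: "f i t = f j t" if "t \<in> T i \<inter> T j" "i < j" for i j t
  proof -
    have "real j \<le> real (Suc i)" using that by (auto simp: T_def)
    then have j: "j = Suc i" using that by simp
    then have "real m * t = real (Suc i)" using that by (auto simp: T_def)
    then show ?thesis by (simp add: f_def j)
  qed
  have agree': "f i t = f j t" if "t \<in> topspace (top_of_set {0..1}) \<inter> T i \<inter> T j" for i j t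
  proof (cases i j rule: linorder_cases)
    case less then show ?thesis using agree[of t i j] that by blast
  next
    case greater then show ?thesis using agree[of t j i] that by fastforce
  qed simp
  obtain p where p: "continuous_map (top_of_set {0..1}) (realization X) p"
    "\<And>t k. k \<in> {..<m} \<Longrightarrow> t \<in> topspace (top_of_set {0..1}) \<inter> T k \<Longrightarrow> p t = f k t"
    by (rule pasting_lemma_exists_closed[OF finite_lessThan cov clo cont agree']) blast+
  show thesis
  proof (rule that[of p])
    show "pathin (realization X) p" using p by (simp add: pathin_def)
    fix k t assume k: "k < m" "real k \<le> real m * t" "real m * t \<le> real (Suc k)"
    have "0 \<le> real m * t" using k(2) by linarith
    then have "0 \<le> t" using m by (simp add: zero_le_mult_iff)
    moreover have "real (Suc k) \<le> real m" using k(1) by (simp only: of_nat_le_iff Suc_le_eq)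
    then have "real m * t \<le> real m * 1" using k(3) by linarith
    then have "t \<le> 1" using m by (simp only: mult_le_cancel_left_pos of_nat_0_less_iff)
    ultimately have "t \<in> T k" using k by (simp add: T_def)
    then show "p t = segment_point (c k) (c (Suc k)) (real m * t - k)"
      using p(2)[of k t] k by (auto simp: f_def T_def)
  qed
qed

text \<open>Open stars of vertices in different graph components are disjoint by
  \<open>star_near\<close>, so a proper component would separate the realization into two open
  sets.\<close>

lemma connected_vertices:
  assumes conn: "path_connected_space (realization X)" and uv: "u \<in> vertices X" "v \<in> vertices X"
  shows "(adjacent X)\<^sup>*\<^sup>* u v"
proof (rule ccontr)
  assume n: "\<not> ?thesis"
  define C where "C = {w. (adjacent X)\<^sup>*\<^sup>* u w}"
  define E1 where "E1 = (\<Union>w\<in>C. open_star X w)"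
  define E2 where "E2 = (\<Union>w\<in>-C. open_star X w)"
  have vp: "vertex_point w \<in> open_star X w" if "w \<in> vertices X" for w
    using segment_point_cell[OF that near_refl, of 0]
    by (simp add: open_star_def closed_cell_def vertex_point_def)
  have "openin (realization X) E1" "openin (realization X) E2"
    unfolding E1_def E2_def by (auto intro!: openin_Union simp: openin_open_star)
  moreover have "topspace (realization X) \<subseteq> E1 \<union> E2"
  proof
    fix x assume "x \<in> topspace (realization X)"
    then have x: "x \<in> realization_points X" by (simp add: topspace_realization)
    then have "{v. x v \<noteq> 0} \<noteq> {}" using simplex_nonempty by (auto simp only: realization_points_def)
    then obtain w where "x w \<noteq> 0" by blast
    then have "x \<in> open_star X w" using x by (auto simp: open_star_def realization_points_def less_le)
    then show "x \<in> E1 \<union> E2" by (auto simp: E1_def E2_def)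
  qed
  moreover have "E1 \<inter> E2 = {}"
  proof -
    have False if "x \<in> open_star X w" "x \<in> open_star X w'" "w \<in> C" "w' \<notin> C" for x w w'
      using star_near[OF that(1,2)] that(3,4)
      by (auto simp: C_def near_def dest: rtranclp.rtrancl_into_rtrancl)
    then show ?thesis by (auto simp: E1_def E2_def)
  qed
  moreover have "vertex_point u \<in> E1" "vertex_point v \<in> E2"
    using vp uv n by (auto simp: E1_def E2_def C_def)
  ultimately have "\<not> connected_space (realization X)" unfolding connected_space_def by blast
  then show False using path_connected_imp_connected_space[OF conn] by simp
qed

text \<open>Simplicial approximation of a null-homotopy: each grid point receives a vertex whose
  open star contains the image of a whole box around it. Neighbouring boxes contain each other's
  centres, so their stars meet and their vertices are near.\<close>

lemma loops_grid_null:
  assumes sc: "simply_connected_space (realization X)"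
    and closed: "c m = c 0" and step: "\<forall>i<m. near (c i) (c (Suc i))" and c0: "c 0 \<in> vertices X" and m: "0 < m"
  shows "grid_null c m"
proof -
  have cV: "c i \<in> vertices X" if "i \<le> m" for i
    using that
  proof (induction i)
    case (Suc i)
    then have "near (c i) (c (Suc i))" "c i \<in> vertices X" using step by auto
    then show ?case using adjacent_vertices adj_sym by (auto simp: near_def)
  qed (use c0 in simp)
  obtain p where p: "pathin (realization X) p"
    and pe: "\<And>k (t::real). k < m \<Longrightarrow> real k \<le> real m * t \<Longrightarrow> real m * t \<le> real (Suc k) \<Longrightarrow> p t = segment_point (c k) (c (Suc k)) (real m * t - real k)"
  proof (rule edge_path[of m c])
    show "near (c i) (c (Suc i))" if "i < m" for i using step that by blast
  qed (use cV m in auto)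
  have p0: "p 0 = vertex_point (c 0)" using pe[of 0 0] m by simp
  have "p 1 = segment_point (c (m - 1)) (c m) 1" using pe[of "m - 1" 1] m by (simp add: of_nat_diff)
  then have p1: "p 1 = vertex_point (c 0)" using closed by simp
  define Q where "Q = ({0..1} :: real set) \<times> ({0..1} :: real set)"
  have hw: "homotopic_with (\<lambda>r. r 0 = p 0 \<and> r 1 = p 0) (top_of_set {0..1}) (realization X) p (\<lambda>_. p 0)"
  proof -
    have "p 0 = p 1" using p0 p1 by simp
    then show ?thesis using sc p unfolding simply_connected_space_def by blast
  qed
  obtain h where h: "continuous_map (top_of_set Q) (realization X) h"
     and h0: "\<And>s. h (0, s) = p s" and h1: "\<And>s. h (1, s) = p 0"
     and hb: "\<And>t. t \<in> {0..1} \<Longrightarrow> h (t, 0) = p 0 \<and> h (t, 1) = p 0"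
    using hw unfolding homotopic_with_def prod_topology_subtopology_eu Q_def by blast
  have "\<exists>W. open W \<and> {z \<in> Q. h z \<in> open_star X w} = Q \<inter> W" for w
  proof -
    have "openin (top_of_set Q) {z \<in> topspace (top_of_set Q). h z \<in> open_star X w}"
      using openin_continuous_map_preimage[OF h openin_open_star] .
    then show ?thesis unfolding openin_open by simp
  qed
  then obtain W where W: "\<And>w. open (W w)" "\<And>w. {z \<in> Q. h z \<in> open_star X w} = Q \<inter> W w" by metis
  have sub: "Q \<subseteq> \<Union> (range W)"
  proof
    fix z assume z: "z \<in> Q"
    then have x: "h z \<in> realization_points X" using h by (auto simp: continuous_map_def topspace_realization Q_def)
    then have "{v. h z v \<noteq> 0} \<noteq> {}" using simplex_nonempty by (auto simp only: realization_points_def)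
    then obtain w where "h z w \<noteq> 0" by blast
    then have "h z \<in> open_star X w" using x by (auto simp: open_star_def realization_points_def less_le)
    then show "z \<in> \<Union> (range W)" using W(2)[of w] z by blast
  qed
  have cmp: "compact Q" by (simp add: Q_def compact_Times)
  have op: "\<And>B. B \<in> range W \<Longrightarrow> open B" using W(1) by auto
  obtain \<delta> where \<delta>: "0 < \<delta>" "\<And>T. T \<subseteq> Q \<Longrightarrow> diameter T < \<delta> \<Longrightarrow> \<exists>B\<in>range W. T \<subseteq> B"
    by (rule Lebesgue_number_lemma[OF cmp _ sub op]) blast+
  obtain N' :: nat where N': "4 / \<delta> < N'" using reals_Archimedean2 by blast
  have "0 < 4 / \<delta>" using \<delta> by simp
  then have N'0: "0 < N'" using N' by (cases N') auto
  \<comment> \<open>A multiple of \<open>m\<close>, so that every edge of the loop covers exactly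
    \<open>N'\<close> grid steps and its ends are grid points. The 4 behind \<open>N'\<close> bounds
    the box diameter, 2 for each coordinate.\<close>
  define N where "N = m * N'"
  have N0: "0 < N" using m N'0 by (simp add: N_def)
  have "N' \<le> N" using m by (simp add: N_def)
  then have "real N' \<le> real N" by (simp only: of_nat_le_iff)
  then have "4 / \<delta> < N" using N' by linarith
  then have N\<delta>: "4 / N < \<delta>" using \<delta> N0 by (simp add: field_simps)
  define T where "T i j = {z \<in> Q. \<bar>fst z - real j / N\<bar> \<le> 1 / N \<and> \<bar>snd z - real i / N\<bar> \<le> 1 / N}" for i j
  have "\<exists>w. T i j \<subseteq> W w" for i j
  proof -
    have "norm (z - z') \<le> 4 / N" if "z \<in> T i j" "z' \<in> T i j" for z z'
    proof -
      have "\<bar>fst z - fst z'\<bar> \<le> 2 / N" "\<bar>snd z - snd z'\<bar> \<le> 2 / N" using that by (auto simp: T_def)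
      moreover have "norm (z - z') \<le> \<bar>fst z - fst z'\<bar> + \<bar>snd z - snd z'\<bar>"
        using norm_Pair_le[of "fst (z - z')" "snd (z - z')"] unfolding prod.collapse by simp
      ultimately show ?thesis by simp
    qed
    then have "diameter (T i j) \<le> 4 / N" by (intro diameter_le) auto
    then have "diameter (T i j) < \<delta>" using N\<delta> by simp
    moreover have "T i j \<subseteq> Q" by (auto simp: T_def)
    ultimately show ?thesis using \<delta>(2) by blast
  qed
  then obtain w where w: "\<And>i j. T i j \<subseteq> W (w i j)" by metis
  have pt: "h (real j' / N, real i' / N) \<in> open_star X (w i j)"
    if "i \<le> Suc i'" "i' \<le> Suc i" "j \<le> Suc j'" "j' \<le> Suc j" "i' \<le> N" "j' \<le> N" for i i' j j'
  proof -
    have close: "\<bar>real a / N - real b / N\<bar> \<le> 1 / N" if "a \<le> Suc b" "b \<le> Suc a" for a b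
    proof -
      have "\<bar>real a - real b\<bar> \<le> 1" using that by linarith
      then have "\<bar>real a - real b\<bar> / N \<le> 1 / N" by (intro divide_right_mono) auto
      then show ?thesis by (simp add: diff_divide_distrib[symmetric])
    qed
    have "(real j' / N, real i' / N) \<in> T i j"
      using close[of j' j] close[of i' i] that N0 by (auto simp: T_def Q_def)
    then show ?thesis using w[of i j] W(2)[of "w i j"] unfolding T_def by blast
  qed
  have at_root: "w i j = c 0" if "h (real j / N, real i / N) = p 0" "i \<le> N" "j \<le> N" for i j
    using pt[where i = i and i' = i and j = j and j' = j] that p0 by (auto simp: open_star_def vertex_point_def split: if_splits)
  \<comment> \<open>The bottom point lies on the segment from \<open>c k\<close> to
    \<open>c (Suc k)\<close> with \<open>k = i div N'\<close>, so \<open>w i 0\<close> is one of its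
    ends. Within one segment the choice may alternate, hence \<open>f\<close> need not be
    monotone.\<close>
  define f where "f i = (if w i 0 = c (i div N') then i div N' else Suc (i div N'))" for i
  have bottom: "w i 0 = c (i div N') \<or> (i div N' < m \<and> \<not> N' dvd i \<and> w i 0 = c (Suc (i div N')))" if i: "i \<le> N" for i
  proof (cases "i = N")
    case True
    then show ?thesis using at_root[where i = N and j = 0] h0 p1 p0 N0 N'0 closed by (simp add: N_def)
  next
    case False
    define k where "k = i div N'"
    have k: "k < m" using i False by (simp add: k_def N_def less_mult_imp_div_less)
    have mi: "m * (real i / N) = real i / N'" using m by (simp add: N_def)
    have ik: "k * N' \<le> i" "i < Suc k * N'"
      using dividend_less_div_times[OF N'0, of i] by (simp_all add: k_def)
    then have "real (k * N') \<le> real i" "real i \<le> real (Suc k * N')" by (simp_all only: of_nat_le_iff less_imp_le)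
    then have r: "real k \<le> m * (real i / N)" "m * (real i / N) \<le> real (Suc k)"
      unfolding mi using N'0 by (simp_all only: of_nat_mult pos_le_divide_eq pos_divide_le_eq of_nat_0_less_iff)
    have ps: "p (real i / N) = segment_point (c k) (c (Suc k)) (m * (real i / N) - k)" by (rule pe[OF k r])
    have pos: "0 < p (real i / N) (w i 0)" using pt[where i = i and i' = i and j = 0 and j' = 0] i h0 by (simp add: open_star_def)
    then have "segment_point (c k) (c (Suc k)) (m * (real i / N) - k) (w i 0) \<noteq> 0" unfolding ps by simp
    then have "w i 0 = c k \<or> w i 0 = c (Suc k)" by (rule segment_point_support)
    moreover have "w i 0 = c k" if "N' dvd i"
    proof -
      have "i = k * N'" using that by (simp add: k_def)
      then have "m * (real i / N) - k = 0" unfolding mi using N'0 by simp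
      then have "p (real i / N) = vertex_point (c k)" unfolding ps by simp
      then show ?thesis using pos by (auto simp: vertex_point_def split: if_splits)
    qed
    ultimately show ?thesis using k by (auto simp: k_def)
  qed
  show ?thesis
    unfolding grid_null_def
  proof (intro exI[of _ N] exI[of _ w] exI[of _ f] conjI allI impI)
    fix i i' j j' assume "i \<le> N \<and> i' \<le> N \<and> j \<le> N \<and> j' \<le> N \<and> i \<le> Suc i' \<and> i' \<le> Suc i \<and> j \<le> Suc j' \<and> j' \<le> Suc j"
    then show "near (w i j) (w i' j')" using star_near pt[where i = i and i' = i and j = j and j' = j] pt[where i = i' and i' = i and j = j' and j' = j] by simp
  next
    fix j assume j: "j \<le> N"
    then have "real j / N \<in> {0..1}" using N0 by simp
    then show "w 0 j = c 0" "w N j = c 0" using at_root[where i = 0 and j = j] at_root[where i = N and j = j] hb[of "real j / N"] j N0 by auto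
  next
    fix i assume "i \<le> N"
    then show "w i N = c 0" using at_root[where i = i and j = N] h1 N0 by simp
  next
    fix i assume i: "i \<le> N"
    show "w i 0 = c (f i)" using bottom[OF i] by (auto simp: f_def)
    show "f i \<le> m"
    proof (cases "w i 0 = c (i div N')")
      case True
      then show ?thesis using i div_le_mono[OF i, of N'] N'0 by (simp add: f_def N_def)
    next
      case False
      then show ?thesis using bottom[OF i] by (auto simp: f_def)
    qed
  next
    show "f 0 = 0" using bottom[of 0] by (auto simp: f_def)
    show "f N = m" using bottom[of N] N'0 by (auto simp: f_def N_def)
  next
    fix i assume i: "i < N"
    \<comment> \<open>Within a segment both values are \<open>k\<close> or \<open>Suc k\<close>. At
      a multiple of \<open>N'\<close> the point is a vertex, which forces the value to be the
      quotient.\<close>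
    have "f i \<le> Suc (f (Suc i)) \<and> f (Suc i) \<le> Suc (f i)"
    proof (cases "N' dvd Suc i")
      case True
      then have "Suc i div N' = Suc (i div N')" using N'0 by (simp add: div_Suc mod_eq_0_iff_dvd)
      moreover have "w (Suc i) 0 = c (Suc i div N')" using bottom[of "Suc i"] i True by auto
      ultimately show ?thesis by (auto simp: f_def)
    next
      case False
      then have "Suc i div N' = i div N'" using N'0 by (simp add: div_Suc mod_eq_0_iff_dvd)
      then show ?thesis by (auto simp: f_def)
    qed
    then show "f i \<le> Suc (f (Suc i))" "f (Suc i) \<le> Suc (f i)" by auto
  qed
qed

end

section \<open>Systolic complexes\<close>

locale systolic_18_complex =
  fixes X :: "'v set set"
  assumes systolic: "systolic 18 X"
begin

sublocale simplicial_complex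
  using systolic by unfold_locales (auto simp: systolic_def large_def flag_complex_def)

sublocale large_graph "adjacent X"
proof unfold_locales
  fix n and c :: "nat \<Rightarrow> 'v"
  assume n: "4 \<le> n" "n < 18" and inj: "inj_on c {..<n}" and ad: "\<forall>i<n. adjacent X (c i) (c (Suc i mod n))"
  have "Suc i mod n < n" for i using n by simp
  then have "cycle_in X (map c [0..<n])"
    using n inj ad by (auto simp: cycle_in_def distinct_map atLeast0LessThan)
  then have "has_diagonal X (map c [0..<n])" using systolic n by (auto simp: systolic_def large_def)
  then obtain i j where "i < n" "j < n" "i \<noteq> j" "j \<noteq> Suc i mod n" "i \<noteq> Suc j mod n" "adjacent X (c i) (c j)"
    by (auto simp: has_diagonal_def)
  then show "\<exists>i<n. \<exists>j<n. i \<noteq> j \<and> j \<noteq> Suc i mod n \<and> i \<noteq> Suc j mod n \<and> adjacent X (c i) (c j)"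
    by blast
qed

lemma simply_connected: "simply_connected_space (realization X)"
  using systolic by (simp add: systolic_def)

sublocale null_graph "adjacent X"
proof unfold_locales
  fix c :: "nat \<Rightarrow> 'v" and m
  assume closed: "c m = c 0" and step: "\<forall>i<m. near (c i) (c (Suc i))"
  show "grid_null c m"
  proof (cases "0 < m \<and> c 0 \<in> vertices X")
    case True
    then show ?thesis using loops_grid_null[OF simply_connected closed step] by blast
  next
    case False
    have const: "c i = c 0" if "i \<le> m" for i
      using that
    proof (induction i)
      case (Suc i)
      then have eq: "c i = c 0" and V: "c 0 \<notin> vertices X" using False by auto
      have "near (c i) (c (Suc i))" using step Suc.prems by (simp add: Suc_le_eq)
      then show ?case using adjacent_vertices V by (auto simp: near_def eq)
    qed simp
    have "\<forall>i\<le>m. c 0 = c (id i) \<and> id i \<le> m"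
    proof (intro allI impI conjI)
      fix i assume "i \<le> m"
      then show "c 0 = c (id i)" "id i \<le> m" using const[of i] by simp_all
    qed
    then show ?thesis
      unfolding grid_null_def by (intro exI[of _ m] exI[of _ "\<lambda>_ _. c 0"] exI[of _ id]) auto
  qed
qed

section \<open>The graph metric and its identification with cover levels\<close>

definition gdist :: "'v \<Rightarrow> 'v \<Rightarrow> nat" where
  "gdist x y = (LEAST n. (adjacent X ^^ n) x y)"

lemma walk: assumes "x \<in> vertices X" "y \<in> vertices X" shows "(adjacent X ^^ gdist x y) x y"
proof -
  have "(adjacent X)\<^sup>*\<^sup>* x y"
    using connected_vertices[OF _ assms] simply_connected by (simp add: simply_connected_space_def)
  then show ?thesis unfolding gdist_def using LeastI_ex by (metis (no_types, lifting) rtranclp_imp_relpowp)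
qed

lemma gdist_le: "(adjacent X ^^ n) x y \<Longrightarrow> gdist x y \<le> n"
  unfolding gdist_def by (rule Least_le)

lemma walk_sym: "(adjacent X ^^ n) x y \<Longrightarrow> (adjacent X ^^ n) y x"
proof (induction n arbitrary: y)
  case (Suc n)
  then obtain z where "(adjacent X ^^ n) x z" "adjacent X z y" by auto
  then show ?case using Suc.IH adj_sym relpowp_Suc_I2 by metis
qed simp

text \<open>Levels grow by at most one along an edge, so they are at most the distance; descending
  through \<open>cover_level_down\<close> gives a walk of exactly that length.\<close>

lemma gdist_lev: assumes r: "r \<in> vertices X" "x \<in> vertices X" shows "gdist r x = cover_level r x"
proof (rule antisym)
  have conn: "(adjacent X)\<^sup>*\<^sup>* r x" if "x \<in> vertices X" for x
    using connected_vertices[OF _ r(1) that] simply_connected by (simp add: simply_connected_space_def)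
  have "cover_level r y \<le> n" if "(adjacent X ^^ n) r y" for n y
    using that
  proof (induction n arbitrary: y)
    case 0 then show ?case using cover_level_root by simp
  next
    case (Suc n)
    then obtain z where z: "(adjacent X ^^ n) r z" "adjacent X z y" by auto
    then show ?case using Suc.IH[OF z(1)] cover_level_adj[OF relpowp_imp_rtranclp[OF z(1)] z(2)] by simp
  qed
  then show "cover_level r x \<le> gdist r x" using walk r by blast
  have "(adjacent X ^^ cover_level r x) r x"
    using r(2)
  proof (induction "cover_level r x" arbitrary: x)
    case 0
    then have "x = r" using cover_level_down[OF conn[OF 0(2)]] by auto
    then show ?case using cover_level_root by simp
  next
    case (Suc n)
    then have "x \<noteq> r" using cover_level_root by auto
    then obtain y where y: "adjacent X x y" "cover_level r x = Suc (cover_level r y)" using cover_level_down[OF conn[OF Suc(3)]] by blast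
    then have "(adjacent X ^^ cover_level r y) r y" using Suc adjacent_vertices[OF adj_sym] by simp
    then show ?case using y adj_sym by auto
  qed
  then show "gdist r x \<le> cover_level r x" by (rule gdist_le)
qed

sublocale bridged_graph "adjacent X" "vertices X" gdist
proof unfold_locales
  have conn: "(adjacent X)\<^sup>*\<^sup>* r x" if "r \<in> vertices X" "x \<in> vertices X" for r x
    using connected_vertices[OF _ that] simply_connected by (simp add: simply_connected_space_def)
  have tri: "gdist x z \<le> gdist x y + gdist y z" if "x \<in> vertices X" "y \<in> vertices X" "z \<in> vertices X" for x y z
    using walk[OF that(1,2)] walk[OF that(2,3)] by (intro gdist_le) (auto simp: relpowp_add)
  have d0: "(gdist x y = 0) = (x = y)" if "x \<in> vertices X" "y \<in> vertices X" for x y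
    using walk[OF that] gdist_le[of 0 x y] by (auto intro: antisym)
  have d1: "(gdist x y = Suc 0) = adjacent X x y" if "x \<in> vertices X" "y \<in> vertices X" for x y
    using walk[OF that] gdist_le[of "Suc 0" x y] d0[OF that] adj_irrefl by (fastforce simp: le_Suc_eq)
  fix x y z r :: 'v and n
  show "adjacent X x y \<Longrightarrow> x \<in> vertices X" by (rule adjacent_vertices)
  show "x \<in> vertices X \<Longrightarrow> y \<in> vertices X \<Longrightarrow> (gdist x y = 0) = (x = y)" by (rule d0)
  show "x \<in> vertices X \<Longrightarrow> y \<in> vertices X \<Longrightarrow> (gdist x y = Suc 0) = adjacent X x y" by (rule d1)
  show "gdist x y = gdist y x" if "x \<in> vertices X" "y \<in> vertices X"
    using gdist_le[OF walk_sym[OF walk[OF that]]] gdist_le[OF walk_sym[OF walk[OF that(2,1)]]] by simp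
  show "x \<in> vertices X \<Longrightarrow> y \<in> vertices X \<Longrightarrow> z \<in> vertices X \<Longrightarrow> gdist x z \<le> gdist x y + gdist y z" by (rule tri)
  show "\<exists>z. adjacent X x z \<and> gdist z y = n" if a: "x \<in> vertices X" "y \<in> vertices X" "gdist x y = Suc n"
  proof -
    have "(adjacent X ^^ Suc n) x y" using walk[OF a(1,2)] a(3) by simp
    then obtain z where z: "adjacent X x z" "(adjacent X ^^ n) z y" using relpowp_Suc_D2 by metis
    have zV: "z \<in> vertices X" using adjacent_vertices[OF adj_sym[OF z(1)]] .
    have "gdist x z = Suc 0" using d1[OF a(1) zV] z(1) by simp
    then have "n \<le> gdist z y" using tri[OF a(1) zV a(2)] a(3) by simp
    then show ?thesis using gdist_le[OF z(2)] z(1) by auto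
  qed
  show "near y z" if a: "r \<in> vertices X" "adjacent X x y" "adjacent X x z" "gdist r x = Suc (gdist r y)" "gdist r x = Suc (gdist r z)"
  proof -
    have V: "x \<in> vertices X" "y \<in> vertices X" "z \<in> vertices X" using a(2,3) adjacent_vertices adj_sym by blast+
    show ?thesis using cover_level_clique[OF conn[OF a(1) V(1)] a(2,3)] a(4,5) gdist_lev[OF a(1)] V by (auto simp: near_def)
  qed
  show "\<exists>z. adjacent X x z \<and> adjacent X y z \<and> gdist r x = Suc (gdist r z)"
    if a: "r \<in> vertices X" "adjacent X x y" "gdist r x = gdist r y"
  proof -
    have V: "x \<in> vertices X" "y \<in> vertices X" using a(2) adjacent_vertices adj_sym by blast+
    obtain z where z: "adjacent X x z" "adjacent X y z" "cover_level r x = Suc (cover_level r z)"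
      using cover_level_triangle[OF conn[OF a(1) V(1)] a(2)] a(3) gdist_lev[OF a(1)] V by auto
    then show ?thesis using gdist_lev[OF a(1)] V adjacent_vertices[OF adj_sym[OF z(1)]] by auto
  qed
qed

lemma graph_dist_le_iff:
  assumes "x \<in> vertices X" "y \<in> vertices X"
  shows "graph_dist X x y \<le> enat N \<longleftrightarrow> gdist x y \<le> N"
proof -
  have "graph_dist X x y = enat (gdist x y)"
    unfolding graph_dist_def
  proof (rule antisym)
    show "(INF n\<in>{n. (adjacent X ^^ n) x y}. enat n) \<le> enat (gdist x y)"
      by (rule INF_lower) (use walk assms in simp)
    show "enat (gdist x y) \<le> (INF n\<in>{n. (adjacent X ^^ n) x y}. enat n)"
      by (rule INF_greatest) (use gdist_le in simp)
  qed
  then show ?thesis by simp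
qed

end

theorem theoremE:
  fixes G :: "('g, 'm) monoid_scheme"
    and X :: "'v set set"
    and \<phi> :: "'g \<Rightarrow> 'v \<Rightarrow> 'v"
  assumes "group G"
    and "finitely_generated G"
    and "systolic 18 X"
    and "simplicial_action G X \<phi>"
    and "strongly_rigid G X \<phi>"
    and "locally_elliptic_action G X \<phi>"
  shows "elliptic_action G X \<phi>"
proof -
  interpret systolic_18_complex X by unfold_locales (rule assms)
  interpret G: group G by (rule assms)
  interpret act: group_action G "vertices X" \<phi> using assms(4) by (simp add: simplicial_action_def)
  have V: "\<phi> g x \<in> vertices X" if "g \<in> carrier G" "x \<in> vertices X" for g x
    using act.element_image that by blast
  have mult: "\<phi> (g \<otimes>\<^bsub>G\<^esub> h) x = \<phi> g (\<phi> h x)" if "g \<in> carrier G" "h \<in> carrier G" "x \<in> vertices X" for g h x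
    using act.composition_rule that by blast
  have one: "\<phi> \<one>\<^bsub>G\<^esub> x = x" if "x \<in> vertices X" for x
    using act.id_eq_one that by (metis restrict_apply')
  have edge: "adjacent X (\<phi> g x) (\<phi> g y)" if g: "g \<in> carrier G" and "adjacent X x y" for g x y
  proof -
    have xy: "x \<in> vertices X" "y \<in> vertices X" "{x, y} \<in> X" "x \<noteq> y"
      using that(2) adj_V adj_V2 by (auto simp: adjacent_def)
    have "\<phi> g ` {x, y} \<in> X"
      using assms(4) g xy unfolding simplicial_action_def by (metis empty_subsetI insert_subset)
    moreover have "\<phi> g x \<noteq> \<phi> g y" using act.inj_prop[OF g] xy by (auto simp: inj_on_def)
    ultimately show ?thesis by (simp add: adjacent_def)
  qed
  have le: "gdist (\<phi> g x) (\<phi> g y) \<le> gdist x y" if g: "g \<in> carrier G" and xy: "x \<in> vertices X" "y \<in> vertices X" for g x y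
  proof -
    have "(adjacent X ^^ n) (\<phi> g x) (\<phi> g y)" if "(adjacent X ^^ n) x y" for n y
      using that by (induction n arbitrary: y) (use edge[OF g] in auto)
    then show ?thesis using walk[OF xy] gdist_le by blast
  qed
  have eq: "gdist (\<phi> g x) (\<phi> g y) = gdist x y" if g: "g \<in> carrier G" and xy: "x \<in> vertices X" "y \<in> vertices X" for g x y
  proof (rule antisym[OF le[OF that]])
    have "\<phi> (inv\<^bsub>G\<^esub> g) (\<phi> g z) = z" if "z \<in> vertices X" for z
      using mult[of "inv\<^bsub>G\<^esub> g" g z] one g that by simp
    then show "gdist x y \<le> gdist (\<phi> g x) (\<phi> g y)"
      using le[of "inv\<^bsub>G\<^esub> g" "\<phi> g x" "\<phi> g y"] V g xy by simp
  qed
  interpret rigid_action "adjacent X" "vertices X" gdist G \<phi>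
  proof unfold_locales
    fix g K u v
    assume g: "g \<in> carrier G" and K: "K \<subseteq> vertices X" "\<And>u v. u \<in> K \<Longrightarrow> v \<in> K \<Longrightarrow> near u v"
      and uv: "u \<in> K" "v \<in> K" "u \<noteq> v" and inv: "\<phi> g ` K = K"
    have "clique X K" using K by (auto simp: clique_def near_def)
    then show "g = \<one>\<^bsub>G\<^esub>" using assms(5) g uv inv unfolding strongly_rigid_def by blast
  next
    fix g x assume g: "g \<in> carrier G" and x: "x \<in> vertices X"
    then have "bounded_in X (orbit (G\<lparr>carrier := generate G {g}\<rparr>) \<phi> x)"
      using assms(6) by (auto simp: locally_elliptic_action_def elliptic_action_def)
    then obtain N where N: "\<And>u v. u \<in> orbit (G\<lparr>carrier := generate G {g}\<rparr>) \<phi> x \<Longrightarrow>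
        v \<in> orbit (G\<lparr>carrier := generate G {g}\<rparr>) \<phi> x \<Longrightarrow> graph_dist X u v \<le> enat N"
      unfolding bounded_in_def by blast
    have "gdist x (\<phi> h x) \<le> N" if h: "h \<in> generate G {g}" for h
    proof -
      have hG: "h \<in> carrier G" using G.generate_in_carrier[of "{g}" h] g h by simp
      have "\<phi> \<one>\<^bsub>G\<^esub> x \<in> orbit (G\<lparr>carrier := generate G {g}\<rparr>) \<phi> x" "\<phi> h x \<in> orbit (G\<lparr>carrier := generate G {g}\<rparr>) \<phi> x"
        using h generate.one by (auto simp: orbit_def)
      then have "graph_dist X x (\<phi> h x) \<le> enat N" using N one x by simp
      then show ?thesis using graph_dist_le_iff V hG x by blast
    qed
    then show "\<exists>c. \<forall>h\<in>generate G {g}. gdist x (\<phi> h x) \<le> c" by blast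
  qed (use V mult one eq in auto)
  show ?thesis
    unfolding elliptic_action_def
  proof
    fix v assume v: "v \<in> vertices X"
    obtain c where c: "\<forall>g\<in>carrier G. \<forall>h\<in>carrier G. gdist (\<phi> g v) (\<phi> h v) \<le> c"
      using action_bounded[OF v] by blast
    then have "graph_dist X a b \<le> enat c" if "a \<in> orbit G \<phi> v" "b \<in> orbit G \<phi> v" for a b
      using that V v by (auto simp: orbit_def graph_dist_le_iff)
    then show "bounded_in X (orbit G \<phi> v)" unfolding bounded_in_def by blast
  qed
qed

end
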